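(* Let $k_1,k_2\ge0$ be integers and let $T^{k_1(1)},T^{k_2(2)}$ be $k_1$- and $k_2$-punctured ball tangle diagrams, respectively, with $$F^{k_1}(T^{k_1(1)})=\left[\begin{matrix} a_{11}&a_{12}&\cdots&a_{12^{k_1}}\\ a_{21}&a_{22}&\cdots&a_{22^{k_1}}\end{matrix}\right],\qquad F^{k_2}(T^{k_2(2)})=\left[\begin{matrix} b_{11}&b_{12}&\cdots&b_{12^{k_2}}\\ b_{21}&b_{22}&\cdots&b_{22^{k_2}}\end{matrix}\right].$$ Then: (1) $F^{k_1+k_2}(T^{k_1(1)}+_hT^{k_2(2)})$ is the class modulo $\pm1$ of the $2\times2^{k_1+k_2}$ matrix whose column number $2^{k_2}(i-1)+j$ is $\begin{pmatrix} a_{1i}b_{2j}+a_{2i}b_{1j}\\ a_{2i}b_{2j}\end{pmatrix}$ for $1\le i\le2^{k_1}$, $1\le j\le2^{k_2}$; (2) $F^{k_1+k_2}(T^{k_1(1)}+_vT^{k_2(2)})$ is the class modulo $\pm1$ of the $2\times2^{k_1+k_2}$ matrix whose column number $2^{k_2}(i-1)+j$ is $\begin{pmatrix} a_{1i}b_{1j}\\ a_{2i}b_{1j}+a_{1i}b_{2j}\end{pmatrix}$ for $1\le i\le2^{k_1}$, $1\le j\le2^{k_2}$.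
   Context: Tangles: let $H_0$ be a closed 3-ball and $H_1,\dots,H_n$ pairwise disjoint closed 3-balls in the interior of $H_0$, all centered in the $xy$-plane; on each $\partial H_k$ ($0\le k\le n$) fix four points NW, NE, SW, SE in the $xy$-plane. An $n$-punctured ball tangle is a properly embedded compact 1-submanifold $T$ of $X=H_0-\bigcup_{i=1}^n\mathrm{Int}(H_i)$ whose boundary is exactly the set of these $4(n+1)$ points, considered up to homeomorphism of $X$ fixing $\partial X$ pointwise and isotopic to the identity rel $\partial X$, and represented by diagrams in the $xy$-plane. For $n=0$ these are ball tangles. Outer connect sums: $T+_hT'$ (horizontal) is obtained by placing $T$ to the left of $T'$ and joining the outer NE and SE endpoints of $T$ to the outer NW and SW endpoints of $T'$, respectively; $T+_vT'$ (vertical) is obtained by placing $T$ above $T'$ and joining the outer SW and SE endpoints of $T$ to the outer NW and NE endpoints of $T'$, respectively (no new crossings). In both, the holes of $T$ (in their order) come before those of $T'$. Kauffman bracket: let $A=e^{i\pi/4}$ and $\Phi=\{z\in\mathbb C:z^8=1\}$. At a crossing of a link diagram the two regions swept by rotating the over-strand counterclockwise are the $A$-regions, the other two the $B$-regions; $A$-type (resp. $B$-type) splitting opens a channel joining the two $A$-regions (resp. $B$-regions). A state $\sigma$ chooses a splitting at each crossing; $\alpha(\sigma),\beta(\sigma)$ are the numbers of $A$-type and $B$-type splittings and $d(\sigma)$ the number of resulting circles. $\langle L\rangle=\sum_{\sigma:\,d(\sigma)=1}A^{\alpha(\sigma)-\beta(\sigma)}$. Invariant: the fundamental tangle $1$ consists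 of two vertical arcs (NW to SW, NE to SE), the fundamental tangle $2$ of two horizontal arcs (NW to NE, SW to SE). The numerator closure (index $1$) joins NW to NE and SW to SE outside the ball without crossings; the denominator closure (index $2$) joins NW to SW and NE to SE. For $m\ge0$, an $m$-punctured ball tangle diagram $T$, $j\in\{1,2\}$ and $\alpha\in\{1,2\}^m$, $T_{j\alpha}$ is the link diagram obtained by filling the $i$-th hole of $T$ with the fundamental tangle $\alpha_i$ for each $i$ and taking the closure of index $j$. Let $\alpha^m_1<\cdots<\alpha^m_{2^m}$ be the elements of $\{1,2\}^m$ in lexicographic order, and let $t_k$ be the number of entries of $\alpha^m_k$ equal to $2$. $F^m(T)$ is the set of integer matrices among $zX(T)$, $z\in\Phi$, where $X(T)$ is the $2\times2^m$ matrix with $(1,k)$ entry $(-i)^{t_k}\langle T_{1\alpha^m_k}\rangle$ and $(2,k)$ entry $(-i)^{t_k}i\langle T_{2\alpha^m_k}\rangle$; this set has the form $\{M,-M\}$, i.e. is an element $[M]$ of $PM_{2\times2^m}(\mathbb Z)=M_{2\times2^m}(\mathbb Z)/\pm1$. *)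

theory Defs
  imports "HOL-Analysis.Path_Connected" "Jordan_Normal_Form.Matrix"
begin

text \<open>
  The projection plane is \<^typ>\<open>complex\<close>.  The outer ball \<open>H\<^sub>0\<close> projects to the closed unit disc, a
  hole \<open>H\<^sub>i\<close> to a round disc \<open>(c, r)\<close> with centre \<open>c\<close> and radius \<open>r\<close>, and the four marked points of
  a disc are those on its diagonals.
\<close>

type_synonym disc = "complex \<times> real"

datatype corner = NW | NE | SW | SE

fun dir :: "corner \<Rightarrow> complex" where
  "dir NE = cis (pi / 4)"
| "dir NW = cis (3 * pi / 4)"
| "dir SW = cis (5 * pi / 4)"
| "dir SE = cis (7 * pi / 4)"

definition pt :: "disc \<Rightarrow> corner \<Rightarrow> complex" where
  "pt D q = fst D + of_real (snd D) * dir q"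

definition corners :: "disc \<Rightarrow> complex set" where
  "corners D = range (pt D)"

definition disc_set :: "disc \<Rightarrow> complex set" where
  "disc_set D = cball (fst D) (snd D)"

definition vertical_arcs :: "disc \<Rightarrow> complex set" where
  "vertical_arcs D = closed_segment (pt D NW) (pt D SW) \<union> closed_segment (pt D NE) (pt D SE)"

definition horizontal_arcs :: "disc \<Rightarrow> complex set" where
  "horizontal_arcs D = closed_segment (pt D NW) (pt D NE) \<union> closed_segment (pt D SW) (pt D SE)"

text \<open>
  A crossing is given by a small round disc in which the diagram consists of the two diagonals,
  together with the information which diagonal is the over-strand.  (Every diagram can be brought
  into this form by an isotopy of the plane.)  The field \<open>strands\<close> below is the part of the diagram
  outside the interiors of these crossing discs.
\<close>

datatype over_strand = Over_NE_SW | Over_NW_SE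

type_synonym crossing = "disc \<times> over_strand"

record diagram =
  crossings :: "crossing set"
  strands :: "complex set"

text \<open>
  Rotating the over-strand NE-SW counterclockwise sweeps the north and south regions; opening a
  channel between them leaves the two vertical arcs.  For the over-strand NW-SE the swept regions
  are west and east.
\<close>

fun A_split :: "crossing \<Rightarrow> complex set" where
  "A_split (D, Over_NE_SW) = vertical_arcs D"
| "A_split (D, Over_NW_SE) = horizontal_arcs D"

fun B_split :: "crossing \<Rightarrow> complex set" where
  "B_split (D, Over_NE_SW) = horizontal_arcs D"
| "B_split (D, Over_NW_SE) = vertical_arcs D"

text \<open>A state is identified with the set \<open>\<sigma>\<close> of crossings at which it chooses the A-type splitting.\<close>

definition resolve :: "'a diagram_scheme \<Rightarrow> crossing set \<Rightarrow> complex set" where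
  "resolve L \<sigma> = strands L \<union> (\<Union>x\<in>\<sigma>. A_split x) \<union> (\<Union>x\<in>crossings L - \<sigma>. B_split x)"

text \<open>For a link diagram the resolved set is a disjoint union of circles, so its connected
  components are these circles.\<close>

definition num_circles :: "'a diagram_scheme \<Rightarrow> crossing set \<Rightarrow> nat" where
  "num_circles L \<sigma> = card (components (resolve L \<sigma>))"

definition kauffman_A :: complex where
  "kauffman_A = exp (\<i> * of_real pi / 4)"

definition bracket :: "'a diagram_scheme \<Rightarrow> complex" where
  "bracket L = (\<Sum>\<sigma> | \<sigma> \<subseteq> crossings L \<and> num_circles L \<sigma> = 1.
     kauffman_A powi (int (card \<sigma>) - int (card (crossings L - \<sigma>))))"

record tangle = diagram +
  holes :: "disc list"

definition outer :: disc where
  "outer = (0, 1)"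

text \<open>\<open>K\<close> is a circle in \<open>U\<close>, or an arc in \<open>U \<union> P\<close> meeting \<open>P\<close> exactly in its endpoints
  (\<open>U\<close> and \<open>P\<close> will be disjoint).\<close>

definition proper_curve :: "complex set \<Rightarrow> complex set \<Rightarrow> complex set \<Rightarrow> bool" where
  "proper_curve U P K \<longleftrightarrow>
     (\<exists>\<gamma>. K = path_image \<gamma> \<and> simple_path \<gamma> \<and> pathfinish \<gamma> = pathstart \<gamma> \<and> K \<subseteq> U) \<or>
     (\<exists>\<gamma>. K = path_image \<gamma> \<and> arc \<gamma> \<and> pathstart \<gamma> \<in> P \<and> pathfinish \<gamma> \<in> P \<and>
          K - {pathstart \<gamma>, pathfinish \<gamma>} \<subseteq> U)"

text \<open>\<open>S\<close> is a compact 1-manifold, properly embedded with boundary \<open>P\<close>.\<close>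

definition proper_one_manifold :: "complex set \<Rightarrow> complex set \<Rightarrow> complex set \<Rightarrow> bool" where
  "proper_one_manifold U P S \<longleftrightarrow>
     P \<subseteq> S \<and>
     (\<exists>\<K>. finite \<K> \<and> disjoint \<K> \<and> \<Union>\<K> = S \<and> (\<forall>K\<in>\<K>. proper_curve U P K))"

definition inner_discs :: "tangle \<Rightarrow> disc set" where
  "inner_discs T = set (holes T) \<union> fst ` crossings T"

definition tangle_diagram :: "nat \<Rightarrow> tangle \<Rightarrow> bool" where
  "tangle_diagram m T \<longleftrightarrow>
     length (holes T) = m \<and> distinct (holes T) \<and>
     finite (crossings T) \<and> inj_on fst (crossings T) \<and>
     set (holes T) \<inter> fst ` crossings T = {} \<and>
     (\<forall>D\<in>inner_discs T. snd D > 0 \<and> disc_set D \<subseteq> ball 0 1) \<and>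
     (\<forall>D\<in>inner_discs T. \<forall>E\<in>inner_discs T. D \<noteq> E \<longrightarrow> disc_set D \<inter> disc_set E = {}) \<and>
     proper_one_manifold
       (ball 0 1 - (\<Union>D\<in>inner_discs T. disc_set D))
       (corners outer \<union> (\<Union>D\<in>inner_discs T. corners D))
       (strands T)"

definition place :: "complex \<Rightarrow> complex \<Rightarrow> complex" where
  "place z p = z + p / 3"

definition place_disc :: "complex \<Rightarrow> disc \<Rightarrow> disc" where
  "place_disc z D = (place z (fst D), snd D / 3)"

text \<open>In a sum, the two summands are shrunk into discs of radius \<open>1/3\<close> centred at \<open>\<mp>1/2\<close>
  (horizontally) or \<open>\<plusminus>\<i>/2\<close> (vertically).  Two segments join the summands to each other, four
  segments join the remaining outer endpoints of the summands to the new outer endpoints.\<close>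

definition juxtapose :: "complex \<Rightarrow> complex \<Rightarrow> complex set \<Rightarrow> tangle \<Rightarrow> tangle \<Rightarrow> tangle" where
  "juxtapose z z' J T T' =
     \<lparr> crossings = map_prod (place_disc z) id ` crossings T \<union>
                   map_prod (place_disc z') id ` crossings T',
       strands = place z ` strands T \<union> place z' ` strands T' \<union> J,
       holes = map (place_disc z) (holes T) @ map (place_disc z') (holes T') \<rparr>"

definition hsum :: "tangle \<Rightarrow> tangle \<Rightarrow> tangle" (infixl "+\<^sub>h" 65) where
  "T +\<^sub>h T' =
     (let z = - 1 / 2; z' = 1 / 2; D = place_disc z outer; D' = place_disc z' outer in
      juxtapose z z'
        (closed_segment (pt D NE) (pt D' NW) \<union> closed_segment (pt D SE) (pt D' SW) \<union>
         closed_segment (pt outer NW) (pt D NW) \<union> closed_segment (pt outer SW) (pt D SW) \<union>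
         closed_segment (pt outer NE) (pt D' NE) \<union> closed_segment (pt outer SE) (pt D' SE))
        T T')"

definition vsum :: "tangle \<Rightarrow> tangle \<Rightarrow> tangle" (infixl "+\<^sub>v" 65) where
  "T +\<^sub>v T' =
     (let z = \<i> / 2; z' = - \<i> / 2; D = place_disc z outer; D' = place_disc z' outer in
      juxtapose z z'
        (closed_segment (pt D SW) (pt D' NW) \<union> closed_segment (pt D SE) (pt D' NE) \<union>
         closed_segment (pt outer NW) (pt D NW) \<union> closed_segment (pt outer NE) (pt D NE) \<union>
         closed_segment (pt outer SW) (pt D' SW) \<union> closed_segment (pt outer SE) (pt D' SE))
        T T')"

definition fundamental :: "nat \<Rightarrow> disc \<Rightarrow> complex set" where
  "fundamental a D = (if a = 1 then vertical_arcs D else horizontal_arcs D)"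

text \<open>The closing arcs run along tangent lines of the unit circle, which meet in
  \<open>\<plusminus>\<surd>2\<i>\<close> and \<open>\<plusminus>\<surd>2\<close>, respectively.\<close>

definition closing_arcs :: "nat \<Rightarrow> complex set" where
  "closing_arcs j =
     (if j = 1 then
        (let n = of_real (sqrt 2) * \<i>; s = - of_real (sqrt 2) * \<i> in
         closed_segment (pt outer NW) n \<union> closed_segment n (pt outer NE) \<union>
         closed_segment (pt outer SW) s \<union> closed_segment s (pt outer SE))
      else
        (let w = - of_real (sqrt 2); e = of_real (sqrt 2) in
         closed_segment (pt outer NW) w \<union> closed_segment w (pt outer SW) \<union>
         closed_segment (pt outer NE) e \<union> closed_segment e (pt outer SE)))"

definition link_of :: "tangle \<Rightarrow> nat \<Rightarrow> nat list \<Rightarrow> diagram" where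
  "link_of T j \<alpha> =
     \<lparr> crossings = crossings T,
       strands = strands T \<union> (\<Union>i<length (holes T). fundamental (\<alpha> ! i) (holes T ! i)) \<union>
                 closing_arcs j \<rparr>"

text \<open>The lists over \<open>{1, 2}\<close> of length \<open>m\<close> in lexicographic order, see \<open>set_words\<close> and
  \<open>sorted_words\<close> below.\<close>

definition words :: "nat \<Rightarrow> nat list list" where
  "words m = product_lists (replicate m [1, 2])"

lemma words_0: "words 0 = [[]]"
  by (simp add: words_def)

lemma words_Suc: "words (Suc m) = map (Cons 1) (words m) @ map (Cons 2) (words m)"
  by (simp add: words_def)

lemma length_words: "length (words m) = 2 ^ m"
  by (induction m) (simp_all add: words_0 words_Suc)

lemma set_words: "set (words m) = {\<alpha>. length \<alpha> = m \<and> set \<alpha> \<subseteq> {1, 2}}"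
proof (induction m)
  case 0
  then show ?case by (auto simp: words_0)
next
  case (Suc m)
  then show ?case by (auto simp: words_Suc length_Suc_conv)
qed

lemma sorted_words: "sorted_wrt (\<lambda>u v. (u, v) \<in> lexord {(x, y). x < y}) (words m)"
  by (induction m) (auto simp: words_0 words_Suc sorted_wrt_append sorted_wrt_map)

text \<open>Rows and columns are counted from \<open>0\<close>.\<close>

definition X_mat :: "nat \<Rightarrow> tangle \<Rightarrow> complex mat" where
  "X_mat m T = mat 2 (2 ^ m) (\<lambda>(r, k).
     let \<alpha> = words m ! k; t = count_list \<alpha> 2 in
     if r = 0 then (- \<i>) ^ t * bracket (link_of T 1 \<alpha>)
     else (- \<i>) ^ t * \<i> * bracket (link_of T 2 \<alpha>))"

definition F_inv :: "nat \<Rightarrow> tangle \<Rightarrow> int mat set" where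
  "F_inv m T = {M. \<exists>z. z ^ 8 = 1 \<and> map_mat of_int M = z \<cdot>\<^sub>m X_mat m T}"

text \<open>The class of \<open>M\<close> in \<open>PM(\<int>) = M(\<int>)/\<plusminus>1\<close>.\<close>

definition pm_class :: "int mat \<Rightarrow> int mat set" where
  "pm_class M = {M, - M}"

end

theory Submission
  imports Defs "HOL-Analysis.Fashoda_Theorem"
begin

text \<open>
  Fill the holes and split the crossings of a tangle. What remains is a compact 1-manifold in the
  unit disc whose boundary consists of the four outer corners, hence two arcs and some circles. By
  the Fashoda theorem the arcs do not join diagonally opposite corners, so they run vertically or
  horizontally. A vertical state without circles closes up to one circle under the numerator closure
  only, a horizontal one under the denominator closure only, and a state with circles under neither.
  The horizontal sum of two states is horizontal if and only if both are, and it acquires a new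
  circle exactly when both are vertical. Hence the numerator of a horizontal sum is connected iff
  one summand has connected numerator and the other connected denominator, and its denominator is
  connected iff both denominators are. Summing over states gives the bilinear formulas for
  the bracket. Rotation by a right angle reduces vertical sums to horizontal ones.
\<close>

section \<open>Gluing arcs in 1-manifolds\<close>

text \<open>Only states with exactly one circle contribute, so circles never have to be counted: the
  condition is that a state together with its closing arcs is connected. Accordingly, the inner
  circles of a state are kept as one compact remainder, which enters through its emptiness alone,
  and its two arcs survive as disjoint compact connected sets. Apart from the Fashoda argument, the
  topology then consists of unions of connected sets with a common point and of separations by
  disjoint closed sets. For the separations, each connecting or closing segment must be shown to
  meet a disc at most in marked points; this follows from its position on or beyond the tangent
  there, or from bounds on coordinates. As no state is connected under both closures, the
  disjunction that governs a sum of tangles turns into a sum of two products. Finally, one integer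
  representative determines the whole invariant, because a real eighth root of unity is 1 or
  -1.\<close>

lemma disjoint_mem_eq:
  assumes "disjoint \<K>" "K \<in> \<K>" "L \<in> \<K>" "x \<in> K" "x \<in> L"
  shows "K = L"
  using assms by (auto simp: pairwise_def disjnt_def)

text \<open>A circle lies in the complement of P, so a component through a point of P can only be an
  arc, and p is one of its ends. Reversing the arc if necessary makes p its final point, the
  orientation used for concatenation.\<close>

lemma proper_curve_boundary_point:
  assumes "proper_curve (- P) P K" "p \<in> K" "p \<in> P"
  obtains \<gamma> where "K = path_image \<gamma>" "arc \<gamma>" "pathfinish \<gamma> = p" "pathstart \<gamma> \<in> P"
    "K \<inter> P = {pathstart \<gamma>, p}"
proof -
  from assms obtain \<gamma> where g: "K = path_image \<gamma>" "arc \<gamma>" "pathstart \<gamma> \<in> P" "pathfinish \<gamma> \<in> P"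
    "K - {pathstart \<gamma>, pathfinish \<gamma>} \<subseteq> - P"
    unfolding proper_curve_def by blast
  then have *: "K \<inter> P = {pathstart \<gamma>, pathfinish \<gamma>}"
    using pathstart_in_path_image[of \<gamma>] pathfinish_in_path_image[of \<gamma>] by auto
  then have "p = pathstart \<gamma> \<or> p = pathfinish \<gamma>"
    using assms by blast
  then show thesis
  proof
    assume "p = pathfinish \<gamma>"
    then show thesis using that g * by blast
  next
    assume "p = pathstart \<gamma>"
    then show thesis
      using that[of "reversepath \<gamma>"] g * by (simp add: arc_reversepath insert_commute)
  qed
qed

lemma proper_curve_mono:
  assumes "proper_curve U P K" "U \<subseteq> U'"
  shows "proper_curve U' P K"
  using assms unfolding proper_curve_def by blast

text \<open>Trading U for the complement of P leaves the boundary as the only datum to track while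
  segments outside U are inserted.\<close>

lemma proper_one_manifold_compl:
  assumes "proper_one_manifold U P S" "U \<inter> P = {}"
  shows "proper_one_manifold (- P) P S"
proof -
  have "U \<subseteq> - P" using assms(2) by blast
  then show ?thesis
    using assms(1) proper_curve_mono unfolding proper_one_manifold_def by metis
qed

text \<open>Both endpoints of an arc belong to K and hence survive the removal of Q from the
  boundary, while the complement of the boundary only grows.\<close>

lemma proper_curve_shrink:
  assumes "proper_curve (- P) P K" "K \<inter> Q = {}"
  shows "proper_curve (- (P - Q)) (P - Q) K"
  using assms(1) unfolding proper_curve_def
proof (elim disjE exE conjE)
  fix \<gamma> assume "K = path_image \<gamma>" "simple_path \<gamma>" "pathfinish \<gamma> = pathstart \<gamma>" "K \<subseteq> - P"
  then show "(\<exists>\<gamma>. K = path_image \<gamma> \<and> simple_path \<gamma> \<and> pathfinish \<gamma> = pathstart \<gamma> \<and> K \<subseteq> - (P - Q)) \<or>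
     (\<exists>\<gamma>. K = path_image \<gamma> \<and> arc \<gamma> \<and> pathstart \<gamma> \<in> P - Q \<and> pathfinish \<gamma> \<in> P - Q \<and>
          K - {pathstart \<gamma>, pathfinish \<gamma>} \<subseteq> - (P - Q))"
    by blast
next
  fix \<gamma> assume g: "K = path_image \<gamma>" "arc \<gamma>" "pathstart \<gamma> \<in> P" "pathfinish \<gamma> \<in> P"
    "K - {pathstart \<gamma>, pathfinish \<gamma>} \<subseteq> - P"
  moreover have "pathstart \<gamma> \<notin> Q" "pathfinish \<gamma> \<notin> Q"
    using assms(2) g(1) pathstart_in_path_image[of \<gamma>] pathfinish_in_path_image[of \<gamma>] by auto
  ultimately show "(\<exists>\<gamma>. K = path_image \<gamma> \<and> simple_path \<gamma> \<and> pathfinish \<gamma> = pathstart \<gamma> \<and> K \<subseteq> - (P - Q)) \<or>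
     (\<exists>\<gamma>. K = path_image \<gamma> \<and> arc \<gamma> \<and> pathstart \<gamma> \<in> P - Q \<and> pathfinish \<gamma> \<in> P - Q \<and>
          K - {pathstart \<gamma>, pathfinish \<gamma>} \<subseteq> - (P - Q))"
    by blast
qed

text \<open>The components of p and q merge with the segment, into a circle if they coincide and
  into one longer arc otherwise. All other components avoid p and q and are unaffected, and p and q
  cease to be boundary points.\<close>

lemma proper_one_manifold_add_segment:
  assumes "proper_one_manifold (- P) P S"
    and p: "p \<in> P" and q: "q \<in> P" and "p \<noteq> q"
    and seg: "closed_segment p q \<inter> S = {p, q}"
  shows "proper_one_manifold (- (P - {p, q})) (P - {p, q}) (S \<union> closed_segment p q)"
proof -
  obtain \<K> where \<K>: "finite \<K>" "disjoint \<K>" "\<Union>\<K> = S"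
    and pc: "\<And>K. K \<in> \<K> \<Longrightarrow> proper_curve (- P) P K" and PS: "P \<subseteq> S"
    using assms(1) unfolding proper_one_manifold_def by blast
  obtain Kp Kq where Kp: "Kp \<in> \<K>" "p \<in> Kp" and Kq: "Kq \<in> \<K>" "q \<in> Kq"
    using p q PS \<K>(3) by blast
  obtain g where g: "Kp = path_image g" "arc g" "pathfinish g = p" "pathstart g \<in> P"
    "Kp \<inter> P = {pathstart g, p}"
    using proper_curve_boundary_point[OF pc[OF Kp(1)] Kp(2) p] by metis
  obtain h where h: "Kq = path_image h" "arc h" "pathfinish h = q" "pathstart h \<in> P"
    "Kq \<inter> P = {pathstart h, q}"
    using proper_curve_boundary_point[OF pc[OF Kq(1)] Kq(2) q] by metis
  have sub: "Kp \<subseteq> S" "Kq \<subseteq> S" using Kp Kq \<K>(3) by auto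
  let ?s = "linepath p q"
  have s: "arc ?s" using \<open>p \<noteq> q\<close> by (rule arc_linepath)
  let ?C = "Kp \<union> closed_segment p q \<union> Kq"
  let ?\<L> = "insert ?C (\<K> - {Kp, Kq})"
  let ?Q = "P - {p, q}"
  have C: "proper_curve (- ?Q) ?Q ?C"
  proof (cases "Kp = Kq")
    case True
    \<comment> \<open>An arc meets P only in its two ends, so q must be the other end of g, and the
      segment closes the arc to a loop.\<close>
    then have "q \<in> {pathstart g, p}"
      using g(5) Kq(2) q by blast
    then have gq: "pathstart g = q" "Kp \<inter> P = {p, q}"
      using g(5) \<open>p \<noteq> q\<close> by auto
    have "simple_path (g +++ ?s)"
      using g gq s seg sub by (intro simple_path_join_loop) auto
    moreover have "path_image (g +++ ?s) = ?C"
      using g True by (auto simp: path_image_join)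
    moreover have "?C \<subseteq> - ?Q"
      using gq seg True PS by auto
    ultimately show ?thesis
      unfolding proper_curve_def using gq by (metis pathfinish_join pathfinish_linepath pathstart_join)
  next
    case False
    have d: "Kp \<inter> Kq = {}"
      using disjoint_mem_eq[OF \<K>(2) Kp(1) Kq(1)] False by blast
    have gs: "arc (g +++ ?s)"
      using g s seg sub d Kq(2) by (intro arc_join) auto
    have "path_image (g +++ ?s) \<inter> Kq \<subseteq> {q}"
    proof
      fix x assume "x \<in> path_image (g +++ ?s) \<inter> Kq"
      then have x: "x \<in> Kq" "x \<in> Kp \<or> x \<in> closed_segment p q"
        using g by (auto simp: path_image_join)
      then have "x \<in> closed_segment p q \<inter> S" using d sub by blast
      then have "x = p \<or> x = q" unfolding seg by simp
      then show "x \<in> {q}" using x(1) d Kp(2) by auto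
    qed
    \<comment> \<open>Both arcs are oriented towards the segment, so h has to be traversed
      backwards.\<close>
    then have all: "arc ((g +++ ?s) +++ reversepath h)"
      using gs g h by (intro arc_join[OF gs]) (auto simp: arc_reversepath)
    have im: "?C = path_image ((g +++ ?s) +++ reversepath h)"
      using g h by (simp add: path_image_join)
    have e: "pathstart g \<noteq> p" "pathstart h \<noteq> q"
      using g h arc_distinct_ends by metis+
    have e': "pathstart g \<noteq> q" "pathstart h \<noteq> p"
      using g h d Kp(2) Kq(2) by auto
    have "?C - {pathstart g, pathstart h} \<subseteq> - ?Q"
      using g(5) h(5) seg PS by auto
    then show ?thesis
      unfolding proper_curve_def using all im e e' g(4) h(4)
      by (intro disjI2 exI[of _ "(g +++ ?s) +++ reversepath h"]) simp
  qed
  have rest: "proper_curve (- ?Q) ?Q K" and restd: "K \<inter> ?C = {}" if "K \<in> \<K> - {Kp, Kq}" for K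
  proof -
    have K: "K \<in> \<K>" "K \<noteq> Kp" "K \<noteq> Kq" "K \<subseteq> S" using that \<K>(3) by auto
    have *: "K \<inter> Kp = {}" "K \<inter> Kq = {}"
      using disjoint_mem_eq[OF \<K>(2) K(1)] K Kp Kq by blast+
    then show "proper_curve (- ?Q) ?Q K"
      using Kp Kq by (intro proper_curve_shrink pc K(1)) auto
    show "K \<inter> ?C = {}"
      using * seg K(4) Kp Kq by auto
  qed
  show ?thesis
    unfolding proper_one_manifold_def
  proof (intro conjI exI[of _ ?\<L>])
    show "?Q \<subseteq> S \<union> closed_segment p q" using PS by auto
    show "finite ?\<L>" using \<K>(1) by simp
    show "disjoint ?\<L>"
      using \<K>(2) restd by (auto simp: pairwise_insert disjnt_def Int_commute intro: pairwise_subset)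
    show "\<Union>?\<L> = S \<union> closed_segment p q" using \<K>(3) Kp Kq by auto
    show "\<forall>K\<in>?\<L>. proper_curve (- ?Q) ?Q K" using C rest by blast
  qed
qed

section \<open>Planarity\<close>

text \<open>Closed half-spaces are convex, so a linear bound at both ends holds on the whole
  segment. Most locations of segments below are obtained from such bounds.\<close>

lemma segment_halfplane:
  fixes a b d p :: "'a :: euclidean_space"
  assumes "p \<in> closed_segment a b" "c \<le> d \<bullet> a" "c \<le> d \<bullet> b"
  shows "c \<le> d \<bullet> p"
proof -
  have "closed_segment a b \<subseteq> {x. d \<bullet> x \<ge> c}"
    using assms by (intro closed_segment_subset convex_halfspace_ge) auto
  then show ?thesis using assms(1) by blast
qed

text \<open>Expanding the squared norm of \<open>p - c - r *\<^sub>R d\<close> bounds it by 0: a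
  ball touches its tangent hyperplane in one point only. Combined with the half-space bound, this
  shows that a segment on or beyond the tangent meets the ball at most in the point of
  contact.\<close>

lemma cball_tangent:
  fixes c d p :: "'a :: euclidean_space"
  assumes "p \<in> cball c r" "norm d = 1" "r \<le> d \<bullet> (p - c)"
  shows "p = c + r *\<^sub>R d"
proof -
  have r: "norm (p - c) \<le> r" using assms(1) by (simp add: dist_norm norm_minus_commute)
  then have r0: "0 \<le> r" using norm_ge_zero order_trans by blast
  have "(norm (y - r *\<^sub>R d))\<^sup>2 = (norm y)\<^sup>2 - 2 * r * (d \<bullet> y) + r\<^sup>2" for y
    using assms(2) unfolding power2_norm_eq_inner norm_eq_1
    by (simp add: inner_diff inner_commute algebra_simps power2_eq_square)
  then have "(norm (p - c - r *\<^sub>R d))\<^sup>2 = (norm (p - c))\<^sup>2 - 2 * r * (d \<bullet> (p - c)) + r\<^sup>2" .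
  also have "\<dots> \<le> r\<^sup>2 - 2 * r * r + r\<^sup>2"
    using r r0 assms(3) by (intro add_mono diff_mono power_mono mult_left_mono) auto
  also have "\<dots> = 0" by (simp add: power2_eq_square)
  finally have "p - c - r *\<^sub>R d = 0" by simp
  then show ?thesis by (simp add: algebra_simps)
qed

lemma dir_Complex:
  "dir NE = Complex (sqrt 2 / 2) (sqrt 2 / 2)" "dir NW = Complex (- sqrt 2 / 2) (sqrt 2 / 2)"
  "dir SW = Complex (- sqrt 2 / 2) (- sqrt 2 / 2)" "dir SE = Complex (sqrt 2 / 2) (- sqrt 2 / 2)"
proof -
  have *: "3 * pi / 4 = pi - pi / 4" "5 * pi / 4 = pi / 4 + pi" "7 * pi / 4 = 2 * pi - pi / 4" by auto
  have "cos (3 * pi / 4) = - sqrt 2 / 2" "sin (3 * pi / 4) = sqrt 2 / 2"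
    "cos (5 * pi / 4) = - sqrt 2 / 2" "sin (5 * pi / 4) = - sqrt 2 / 2"
    "cos (7 * pi / 4) = sqrt 2 / 2" "sin (7 * pi / 4) = - sqrt 2 / 2"
    unfolding * cos_diff sin_diff cos_add sin_add by (simp_all add: cos_45 sin_45)
  then show "dir NE = Complex (sqrt 2 / 2) (sqrt 2 / 2)" "dir NW = Complex (- sqrt 2 / 2) (sqrt 2 / 2)"
    "dir SW = Complex (- sqrt 2 / 2) (- sqrt 2 / 2)" "dir SE = Complex (sqrt 2 / 2) (- sqrt 2 / 2)"
    by (simp_all add: complex_eq_iff cos_45 sin_45)
qed

lemma norm_dir [simp]: "norm (dir q) = 1"
  by (cases q) auto

declare dir.simps [simp del]

lemma dir_eq_iff [simp]: "dir p = dir q \<longleftrightarrow> p = q"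
proof -
  have "sqrt 2 / 2 \<noteq> - (sqrt 2 / 2)" by simp
  then show ?thesis
    by (cases p; cases q) (auto simp: dir_Complex)
qed

lemma pt_outer: "pt outer q = dir q"
  by (simp add: pt_def outer_def)

text \<open>The Fashoda theorem concerns a box, with one path from its left to its right side and
  another from its bottom to its top. Radial segments from the marked points to the corners of the
  square circumscribed about the disc extend f and g to such paths, and a common point of the
  extensions is traced back to f and g.\<close>

lemma crossing_paths_meet:
  assumes "path f" "path g" "path_image f \<subseteq> cball 0 1" "path_image g \<subseteq> cball 0 1"
    and ends: "pathstart f = dir NW" "pathfinish f = dir SE" "pathstart g = dir SW" "pathfinish g = dir NE"
  shows "path_image f \<inter> path_image g \<noteq> {}"
proof -
  \<comment> \<open>The point \<open>sqrt 2 *\<^sub>R dir q\<close> is the corner of the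
    circumscribed square in direction q.\<close>
  define out where "out q = closed_segment (sqrt 2 *\<^sub>R dir q) (dir q)" for q
  define F where "F = linepath (sqrt 2 *\<^sub>R dir NW) (dir NW) +++ f +++ linepath (dir SE) (sqrt 2 *\<^sub>R dir SE)"
  define G where "G = linepath (sqrt 2 *\<^sub>R dir SW) (dir SW) +++ g +++ linepath (dir NE) (sqrt 2 *\<^sub>R dir NE)"
  have s2: "1 \<le> sqrt 2" "sqrt 2 * sqrt 2 = 2" "sqrt 2 \<le> 2" by (auto simp: real_le_lsqrt)
  have F: "path F" "path_image F = out NW \<union> path_image f \<union> out SE"
    and G: "path G" "path_image G = out SW \<union> path_image g \<union> out NE"
    unfolding F_def G_def out_def using assms
    by (auto simp: path_image_join closed_segment_commute)
  \<comment> \<open>\<open>fashoda\<close> speaks of paths in \<open>real^2\<close>, so complex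
    points are transported there by coordinates.\<close>
  define h :: "complex \<Rightarrow> real^2" where "h z = (\<chi> i. if i = 1 then Re z else Im z)" for z
  have h1: "h z $ 1 = Re z" "h z $ 2 = Im z" for z by (auto simp: h_def)
  have hc: "continuous_on A h" for A
    unfolding h_def
  proof (intro continuous_on_vec_lambda)
    show "continuous_on A (\<lambda>z. if i = 1 then Re z else Im z)" for i :: 2
      by (cases "i = 1") (auto intro!: continuous_intros)
  qed
  have hinj: "h z = h w \<Longrightarrow> z = w" for z w
    using h1 by (metis complex_eqI)
  have outbd: "\<bar>Re z\<bar> \<le> 1 \<and> \<bar>Im z\<bar> \<le> 1" if "z \<in> out q" for z q
    using that segment_halfplane[of z "sqrt 2 *\<^sub>R dir q" "dir q" "- 1" "1"]
      segment_halfplane[of z "sqrt 2 *\<^sub>R dir q" "dir q" "- 1" "- 1"]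
      segment_halfplane[of z "sqrt 2 *\<^sub>R dir q" "dir q" "- 1" "\<i>"]
      segment_halfplane[of z "sqrt 2 *\<^sub>R dir q" "dir q" "- 1" "- \<i>"] s2
    by (cases q) (auto simp: out_def dir_Complex inner_complex_def)
  moreover have "\<bar>Re z\<bar> \<le> 1 \<and> \<bar>Im z\<bar> \<le> 1" if "z \<in> cball 0 1" for z
    using that abs_Re_le_cmod[of z] abs_Im_le_cmod[of z] by auto
  ultimately have "h z \<in> cbox (h (Complex (-1) (-1))) (h (Complex 1 1))"
    if "z \<in> cball 0 1 \<or> z \<in> out q" for z q
    using that unfolding mem_box_cart forall_2 h1 by (metis abs_le_iff complex.sel minus_le_iff)
  then have "h ` (path_image F) \<subseteq> cbox (h (Complex (-1) (-1))) (h (Complex 1 1))"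
       "h ` (path_image G) \<subseteq> cbox (h (Complex (-1) (-1))) (h (Complex 1 1))"
    unfolding F G using assms(3,4) by blast+
  then have im: "path_image (h \<circ> F) \<subseteq> cbox (h (Complex (-1) (-1))) (h (Complex 1 1))"
       "path_image (h \<circ> G) \<subseteq> cbox (h (Complex (-1) (-1))) (h (Complex 1 1))"
    by (simp_all only: path_image_compose)
  have pth: "path (h \<circ> F)" "path (h \<circ> G)"
    using F(1) G(1) hc by (simp_all add: path_continuous_image)
  have "pathstart F = Complex (-1) 1" "pathfinish F = Complex 1 (-1)"
    "pathstart G = Complex (-1) (-1)" "pathfinish G = Complex 1 1"
    using s2 by (simp_all add: F_def G_def dir_Complex complex_eq_iff)
  then have e: "pathstart (h \<circ> F) $ 1 = h (Complex (-1) (-1)) $ 1" "pathfinish (h \<circ> F) $ 1 = h (Complex 1 1) $ 1"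
     "pathstart (h \<circ> G) $ 2 = h (Complex (-1) (-1)) $ 2" "pathfinish (h \<circ> G) $ 2 = h (Complex 1 1) $ 2"
    by (simp_all add: pathstart_compose pathfinish_compose h1)
  obtain z where "z \<in> path_image (h \<circ> F)" "z \<in> path_image (h \<circ> G)"
    using fashoda[OF pth im e] by metis
  then obtain p where p: "p \<in> path_image F" "p \<in> path_image G"
    unfolding path_image_compose using hinj by blast
  have tan: "p = dir q" if "p \<in> out q" "p \<in> cball 0 1" for p q
  proof -
    have "1 \<le> dir q \<bullet> p"
      using that s2 by (intro segment_halfplane[of p "sqrt 2 *\<^sub>R dir q" "dir q"])
        (auto simp: out_def power2_norm_eq_inner[symmetric])
    then show ?thesis
      using cball_tangent[of p 0 1 "dir q"] that by simp
  qed
  \<comment> \<open>The products equal 1/2 at the inner end \<open>dir q\<close> and are larger at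
    the outer end. Their positivity puts the four extensions into four different open
    quadrants.\<close>
  have "1 / 2 \<le> (\<i> * of_real (Im (dir q))) \<bullet> p \<and> 1 / 2 \<le> of_real (Re (dir q)) \<bullet> p"
    if "p \<in> out q" for p q
    using that s2
    by (intro conjI segment_halfplane[of p "sqrt 2 *\<^sub>R dir q" "dir q"]; cases q)
      (auto simp: out_def dir_Complex inner_complex_def)
  then have pos: "0 < Im (dir q) * Im p \<and> 0 < Re (dir q) * Re p" if "p \<in> out q" for p q
    using that by (fastforce simp: inner_complex_def)
  have sgn: "Im (dir NW) > 0" "Im (dir NE) > 0" "Im (dir SW) < 0" "Im (dir SE) < 0"
    "Re (dir NW) < 0" "Re (dir NE) > 0" "Re (dir SW) < 0" "Re (dir SE) > 0"
    unfolding dir_Complex by auto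
  have disj: "q = r" if "p \<in> out q" "p \<in> out r" for p q r
    using pos[OF that(1)] pos[OF that(2)] sgn
    by (cases q; cases r; simp only: zero_less_mult_iff corner.simps; linarith)
  have mem: "dir NW \<in> path_image f" "dir SE \<in> path_image f" "dir SW \<in> path_image g" "dir NE \<in> path_image g"
    using ends pathstart_in_path_image pathfinish_in_path_image by metis+
  \<comment> \<open>A common point that lies on an extension and in the disc is the marked point, an
    endpoint of the very path that the extension prolongs. Extensions of different paths do not
    meet.\<close>
  consider "p \<in> path_image f" "p \<in> path_image g" | q where "q = SW \<or> q = NE" "p \<in> path_image f" "p \<in> out q"
    | q where "q = NW \<or> q = SE" "p \<in> out q" "p \<in> path_image g"
    | q r where "q = NW \<or> q = SE" "p \<in> out q" "r = SW \<or> r = NE" "p \<in> out r"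
    using p unfolding F(2) G(2) by blast
  then show ?thesis
  proof cases
    case 2
    then have "p = dir q" using tan assms(3) by blast
    then show ?thesis using 2 mem by blast
  next
    case 3
    then have "p = dir q" using tan assms(4) by blast
    then show ?thesis using 3 mem by blast
  next
    case 4
    then show ?thesis using disj[OF 4(2,4)] by blast
  qed blast
qed

text \<open>K and L stand for the two arcs of a state, R for its circles. Connectedness is retained
  because it joins pieces, compactness because, through closedness, it separates them.\<close>

definition two_strands :: "complex \<Rightarrow> complex \<Rightarrow> complex \<Rightarrow> complex \<Rightarrow> complex set \<Rightarrow> complex set \<Rightarrow> bool" where
  "two_strands a b c d S R \<longleftrightarrow>
     (\<exists>K L. S = K \<union> L \<union> R \<and> compact K \<and> connected K \<and> compact L \<and> connected L \<and> compact R \<and>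
        K \<inter> L = {} \<and> K \<inter> R = {} \<and> L \<inter> R = {} \<and> {a, b} \<subseteq> K \<and> {c, d} \<subseteq> L)"

lemma two_strandsE:
  assumes "two_strands a b c d S R"
  obtains K L where "S = K \<union> L \<union> R" "compact K" "connected K" "compact L" "connected L" "compact R"
    "K \<inter> L = {}" "K \<inter> R = {}" "L \<inter> R = {}" "a \<in> K" "b \<in> K" "c \<in> L" "d \<in> L"
    "a \<notin> L" "b \<notin> L" "c \<notin> K" "d \<notin> K" "a \<notin> R" "b \<notin> R" "c \<notin> R" "d \<notin> R"
proof -
  obtain K L where KL: "S = K \<union> L \<union> R" "compact K" "connected K" "compact L" "connected L" "compact R"
    "K \<inter> L = {}" "K \<inter> R = {}" "L \<inter> R = {}" "{a, b} \<subseteq> K" "{c, d} \<subseteq> L"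
    using assms unfolding two_strands_def by (elim exE conjE) (rule that)
  then have "a \<in> K" "b \<in> K" "c \<in> L" "d \<in> L" by auto
  moreover from this have "a \<notin> L" "b \<notin> L" "c \<notin> K" "d \<notin> K" "a \<notin> R" "b \<notin> R" "c \<notin> R" "d \<notin> R"
    using KL(7-9) by blast+
  ultimately show thesis by (intro that[OF KL(1-9)])
qed

definition vertical_type :: "complex set \<Rightarrow> complex set \<Rightarrow> bool" where
  "vertical_type S R \<longleftrightarrow> S \<subseteq> cball 0 1 \<and> two_strands (dir NW) (dir SW) (dir NE) (dir SE) S R"

definition horizontal_type :: "complex set \<Rightarrow> complex set \<Rightarrow> bool" where
  "horizontal_type S R \<longleftrightarrow> S \<subseteq> cball 0 1 \<and> two_strands (dir NW) (dir NE) (dir SW) (dir SE) S R"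

definition planar_type :: "complex set \<Rightarrow> bool" where
  "planar_type S \<longleftrightarrow> (\<exists>R. vertical_type S R \<or> horizontal_type S R)"

lemma corners_eq: "corners D = {pt D NW, pt D NE, pt D SW, pt D SE}"
proof -
  have "UNIV = {NW, NE, SW, SE}" using corner.exhaust by auto
  then have "corners D = pt D ` {NW, NE, SW, SE}" by (simp only: corners_def)
  then show ?thesis by simp
qed

lemma corners_outer: "corners outer = {dir NW, dir NE, dir SW, dir SE}"
  unfolding corners_eq pt_outer ..

lemma proper_curve_compact_connected:
  assumes "proper_curve U P K" shows "compact K" "connected K"
  using assms unfolding proper_curve_def
  by (auto simp: compact_path_image connected_path_image arc_imp_path simple_path_imp_path)

text \<open>Finiteness of the family makes the union R of all remaining components compact.\<close>

lemma manifold_two_strands: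
  assumes "finite \<K>" "disjoint \<K>" "\<And>M. M \<in> \<K> \<Longrightarrow> proper_curve U P M" "S = \<Union>\<K>"
    and "K \<in> \<K>" "L \<in> \<K>" "K \<noteq> L" "{a, b} \<subseteq> K" "{c, d} \<subseteq> L"
  shows "\<exists>R. two_strands a b c d S R"
proof -
  define R where "R = \<Union>(\<K> - {K, L})"
  note cc = proper_curve_compact_connected[OF assms(3)]
  have "compact R"
    unfolding R_def using assms(1) cc by (intro compact_Union) auto
  moreover have "M \<inter> N = {}" if "M \<in> \<K>" "N \<in> \<K>" "M \<noteq> N" for M N
    using disjoint_mem_eq[OF assms(2)] that by blast
  then have "K \<inter> L = {}" "K \<inter> R = {}" "L \<inter> R = {}"
    using assms(5-7) unfolding R_def by blast+
  moreover have "S = K \<union> L \<union> R"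
    using assms(4-6) unfolding R_def by blast
  ultimately show ?thesis
    unfolding two_strands_def using cc assms(5-9) by metis
qed

text \<open>The component through NW ends at a second corner q, and the component through a further
  corner can only end at the last one. For q = NE or q = SW this is the horizontal or the vertical
  pattern; q = SE would give two disjoint paths between opposite corners.\<close>

lemma planar_type_manifold:
  assumes "proper_one_manifold (- corners outer) (corners outer) S" "S \<subseteq> cball 0 1"
  shows "planar_type S"
proof -
  let ?P = "corners outer"
  obtain \<K> where \<K>: "finite \<K>" "disjoint \<K>" "\<Union>\<K> = S"
    and pc: "\<And>K. K \<in> \<K> \<Longrightarrow> proper_curve (- ?P) ?P K" and PS: "?P \<subseteq> S"
    using assms(1) unfolding proper_one_manifold_def by blast
  have arc: "\<exists>K \<gamma>. K \<in> \<K> \<and> K = path_image \<gamma> \<and> arc \<gamma> \<and> pathfinish \<gamma> = p \<and> pathstart \<gamma> \<in> ?P \<and>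
      K \<inter> ?P = {pathstart \<gamma>, p} \<and> pathstart \<gamma> \<noteq> p" if p: "p \<in> ?P" for p
  proof -
    obtain K where "K \<in> \<K>" "p \<in> K" using PS \<K>(3) p by blast
    then show ?thesis
      using proper_curve_boundary_point[OF pc _ p] arc_distinct_ends by metis
  qed
  have P: "dir q \<in> ?P" for q by (cases q) (simp_all only: corners_outer insert_iff simp_thms)
  obtain K f where K: "K \<in> \<K>" "K = path_image f" "arc f" "pathfinish f = dir NW" "pathstart f \<in> ?P"
      "K \<inter> ?P = {pathstart f, dir NW}" "pathstart f \<noteq> dir NW"
    using arc[OF P[of NW]] by blast
  then obtain q where q: "pathstart f = dir q" "q \<noteq> NW"
    unfolding corners_outer by auto
  \<comment> \<open>The corners NW and q are taken by K, so only r is left as the other end of the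
    component through p.\<close>
  have two: "\<exists>L g. L \<in> \<K> \<and> L \<noteq> K \<and> L = path_image g \<and> arc g \<and> pathfinish g = dir p \<and> pathstart g = dir r"
    if "distinct [q, p, r, NW]" for p r
  proof -
    obtain L g where L: "L \<in> \<K>" "L = path_image g" "arc g" "pathfinish g = dir p" "pathstart g \<in> ?P"
      "pathstart g \<noteq> dir p"
      using arc[OF P[of p]] by blast
    have "dir p \<in> L" using L pathfinish_in_path_image by metis
    moreover have "dir p \<notin> K"
    proof
      assume "dir p \<in> K"
      then have "dir p \<in> {dir q, dir NW}" using K(6) P[of p] unfolding q(1) by blast
      then show False using that by simp
    qed
    ultimately have "L \<noteq> K" by blast
    then have "L \<inter> K = {}" using disjoint_mem_eq[OF \<K>(2) L(1) K(1)] by blast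
    moreover obtain x where x: "pathstart g = dir x" using L(5) unfolding corners_outer by auto
    moreover have "dir x \<in> L" using L x pathstart_in_path_image by metis
    moreover have "dir q \<in> K" "dir NW \<in> K" using K(6) q(1) by auto
    ultimately have "x \<noteq> q" "x \<noteq> NW" "x \<noteq> p" using L(6) by auto
    then have "x = r" using that by (cases x; cases q; cases p; cases r; simp)
    then show ?thesis using L x \<open>L \<noteq> K\<close> by blast
  qed
  have ends: "{dir p, dir r} \<subseteq> L" if "L = path_image g" "pathfinish g = dir p" "pathstart g = dir r" for L g p r
    using that pathstart_in_path_image[of g] pathfinish_in_path_image[of g] by simp
  have Kends: "{dir NW, dir q} \<subseteq> K" using ends K(2,4) q(1) by blast
  show ?thesis
  proof (cases q)
    case NW then show ?thesis using q by simp
  next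
    case NE
    then obtain L g where L: "L \<in> \<K>" "L \<noteq> K" "L = path_image g" "pathfinish g = dir SW" "pathstart g = dir SE"
      using two[of SW SE] by auto
    then show ?thesis
      unfolding planar_type_def horizontal_type_def
      using manifold_two_strands[OF \<K>(1,2) pc \<K>(3)[symmetric] K(1) L(1) L(2)[symmetric] Kends ends[OF L(3-5)]]
        NE assms(2) by blast
  next
    case SW
    then obtain L g where L: "L \<in> \<K>" "L \<noteq> K" "L = path_image g" "pathfinish g = dir NE" "pathstart g = dir SE"
      using two[of NE SE] by auto
    then show ?thesis
      unfolding planar_type_def vertical_type_def
      using manifold_two_strands[OF \<K>(1,2) pc \<K>(3)[symmetric] K(1) L(1) L(2)[symmetric] Kends ends[OF L(3-5)]]
        SW assms(2) by blast
  next
    case SE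
    then obtain L g where L: "L \<in> \<K>" "L \<noteq> K" "L = path_image g" "arc g" "pathfinish g = dir NE" "pathstart g = dir SW"
      using two[of NE SW] by auto
    have "K \<subseteq> cball 0 1" "L \<subseteq> cball 0 1" using K(1) L(1) \<K>(3) assms(2) by auto
    then have "path_image (reversepath f) \<inter> path_image g \<noteq> {}"
      using K L q SE by (intro crossing_paths_meet) (simp_all add: arc_imp_path)
    then have "K \<inter> L \<noteq> {}" using K(2) L(3) by simp
    then show ?thesis using disjoint_mem_eq[OF \<K>(2) L(1) K(1)] L(2) by blast
  qed
qed

section \<open>Closures and rotation\<close>

lemma not_connected_Un:
  assumes "closed A" "closed B" "A \<inter> B = {}" "A \<noteq> {}" "B \<noteq> {}"
  shows "\<not> connected (A \<union> B)"
  using assms unfolding connected_closed by blast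

lemma connected_Un_common: "connected A \<Longrightarrow> connected B \<Longrightarrow> x \<in> A \<Longrightarrow> x \<in> B \<Longrightarrow> connected (A \<union> B)"
  by (intro connected_Un) auto

lemma Int_empty_by_ends: "E \<inter> D \<subseteq> {p, q} \<Longrightarrow> X \<subseteq> D \<Longrightarrow> p \<notin> X \<Longrightarrow> q \<notin> X \<Longrightarrow> E \<inter> X = {}"
  by blast

text \<open>Each of the four segments lies on a tangent line of the unit circle, since the inner
  product of its marked direction with m (or - m in the south) is 1; hence it touches the disc at
  the marked point only. The northern and the southern arc are separated by height, with imaginary
  parts at least 1/2 and at most -1/2.\<close>

lemma closing_arcs_1:
  obtains n s where "closing_arcs 1 = n \<union> s" "compact n" "compact s" "connected n" "connected s"
    "n \<inter> s = {}" "{dir NW, dir NE} \<subseteq> n" "{dir SW, dir SE} \<subseteq> s"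
    "n \<inter> cball 0 1 \<subseteq> {dir NW, dir NE}" "s \<inter> cball 0 1 \<subseteq> {dir SW, dir SE}"
proof -
  define m where "m = of_real (sqrt 2) * \<i>"
  define n where "n = closed_segment (dir NW) m \<union> closed_segment (dir NE) m"
  define s where "s = closed_segment (dir SW) (- m) \<union> closed_segment (dir SE) (- m)"
  have s2: "1 \<le> sqrt 2 * 2" "sqrt 2 * sqrt 2 = 2" using real_sqrt_mult_self[of 2] real_sqrt_ge_one[of 2] by linarith+
  have tan: "p = dir q"
    if "p \<in> cball 0 1" "p \<in> closed_segment (dir q) x" "dir q \<bullet> x = 1" for p q x
    using cball_tangent[of p 0 1 "dir q"] segment_halfplane[OF that(2), of 1 "dir q"] that
    by (simp add: power2_norm_eq_inner[symmetric])
  have "dir NW \<bullet> m = 1" "dir NE \<bullet> m = 1" "dir SW \<bullet> (- m) = 1" "dir SE \<bullet> (- m) = 1"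
    using s2 unfolding dir_Complex m_def inner_complex_def by (auto simp: field_simps)
  then have t: "n \<inter> cball 0 1 \<subseteq> {dir NW, dir NE}" "s \<inter> cball 0 1 \<subseteq> {dir SW, dir SE}"
    using tan unfolding n_def s_def by blast+
  have "1 / 2 \<le> \<i> \<bullet> p" if "p \<in> n" for p
    using that s2 unfolding n_def Un_iff
    by (elim disjE segment_halfplane; unfold dir_Complex m_def inner_complex_def) (auto simp: s2)
  moreover have "1 / 2 \<le> - \<i> \<bullet> p" if "p \<in> s" for p
    using that s2 unfolding s_def Un_iff
    by (elim disjE segment_halfplane; unfold dir_Complex m_def inner_complex_def) (auto simp: s2)
  ultimately have "n \<inter> s = {}" by fastforce
  moreover have "closing_arcs 1 = n \<union> s"
    by (simp add: closing_arcs_def pt_outer n_def s_def m_def Let_def Un_assoc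
      closed_segment_commute[of _ "dir NE"] closed_segment_commute[of _ "dir SE"])
  moreover have "connected n" "connected s"
    unfolding n_def s_def
    by (rule connected_Un_common[where x = m] connected_Un_common[where x = "- m"]; simp)+
  ultimately show thesis using that[of n s] t
    by (simp add: n_def s_def compact_Un)
qed

text \<open>The pieces n, K, s, L form one chain in which each meets its predecessors in a corner,
  whereas R is closed and away from all of them: it avoids the corners, the only places where n and
  s meet the disc.\<close>

lemma closure_1_vertical:
  assumes "vertical_type S R"
  shows "connected (S \<union> closing_arcs 1) \<longleftrightarrow> R = {}"
proof -
  obtain n s where ns: "closing_arcs 1 = n \<union> s" "compact n" "compact s" "connected n" "connected s"
    "n \<inter> s = {}" "{dir NW, dir NE} \<subseteq> n" "{dir SW, dir SE} \<subseteq> s"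
    "n \<inter> cball 0 1 \<subseteq> {dir NW, dir NE}" "s \<inter> cball 0 1 \<subseteq> {dir SW, dir SE}"
    by (rule closing_arcs_1)
  from assms have S: "S \<subseteq> cball 0 1" by (simp add: vertical_type_def)
  from assms have "two_strands (dir NW) (dir SW) (dir NE) (dir SE) S R" by (simp add: vertical_type_def)
  then obtain K L where KL: "S = K \<union> L \<union> R" "compact K" "connected K" "compact L" "connected L" "compact R"
        "K \<inter> L = {}" "K \<inter> R = {}" "L \<inter> R = {}"
        "dir NW \<in> K" "dir SW \<in> K" "dir NE \<in> L" "dir SE \<in> L"
        "dir NW \<notin> R" "dir SW \<notin> R" "dir NE \<notin> R" "dir SE \<notin> R"
    by (rule two_strandsE)
  let ?M = "n \<union> K \<union> s \<union> L"
  have "connected (n \<union> K)"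
    using ns(4,7) KL(3,10,11) connected_Un_common[of "n" "K" "dir NW"] by auto
  then have "connected (n \<union> K \<union> s)"
    using ns(5,8) KL(10,11) connected_Un_common[of "n \<union> K" "s" "dir SW"] by auto
  then have "connected ?M"
    using ns(7) KL(5,12) connected_Un_common[of "n \<union> K \<union> s" "L" "dir NE"] by auto
  moreover have "R \<subseteq> cball 0 1" using KL(1) S by blast
  then have "n \<inter> R = {}" "s \<inter> R = {}"
    using KL(14-17) by (simp_all add: Int_empty_by_ends[OF ns(9)] Int_empty_by_ends[OF ns(10)])
  then have "?M \<inter> R = {}" using KL(8,9) by blast
  moreover have "closed ?M" "closed R" "?M \<noteq> {}"
    using ns KL by (auto intro!: closed_Un compact_imp_closed)
  moreover have "S \<union> closing_arcs 1 = ?M \<union> R" using KL(1) ns(1) by blast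
  ultimately show ?thesis using not_connected_Un[of ?M R] by auto
qed

text \<open>The northern arc meets only K and the southern arc only L, which leaves two disjoint
  nonempty closed sets.\<close>

lemma closure_1_horizontal:
  assumes "horizontal_type S R"
  shows "\<not> connected (S \<union> closing_arcs 1)"
proof -
  obtain n s where ns: "closing_arcs 1 = n \<union> s" "compact n" "compact s" "connected n" "connected s"
    "n \<inter> s = {}" "{dir NW, dir NE} \<subseteq> n" "{dir SW, dir SE} \<subseteq> s"
    "n \<inter> cball 0 1 \<subseteq> {dir NW, dir NE}" "s \<inter> cball 0 1 \<subseteq> {dir SW, dir SE}"
    by (rule closing_arcs_1)
  from assms have S: "S \<subseteq> cball 0 1" by (simp add: horizontal_type_def)
  from assms have "two_strands (dir NW) (dir NE) (dir SW) (dir SE) S R" by (simp add: horizontal_type_def)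
  then obtain K L where KL: "S = K \<union> L \<union> R" "compact K" "connected K" "compact L" "connected L" "compact R"
        "K \<inter> L = {}" "K \<inter> R = {}" "L \<inter> R = {}"
        "dir NW \<notin> L" "dir NE \<notin> L" "dir SW \<notin> K" "dir SE \<notin> K"
        "dir NW \<notin> R" "dir NE \<notin> R" "dir SW \<notin> R" "dir SE \<notin> R"
    by (rule two_strandsE)
  have "K \<subseteq> cball 0 1" "L \<subseteq> cball 0 1" "R \<subseteq> cball 0 1" using KL(1) S by auto
  then have "n \<inter> R = {}" "s \<inter> R = {}" "n \<inter> L = {}" "s \<inter> K = {}"
    using KL(10-17) by (simp_all add: Int_empty_by_ends[OF ns(9)] Int_empty_by_ends[OF ns(10)])
  then have "(n \<union> K) \<inter> (s \<union> L \<union> R) = {}" using KL(7,8) ns(6) by blast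
  moreover have "closed (n \<union> K)" "closed (s \<union> L \<union> R)" 
    using ns KL by (auto intro!: closed_Un compact_imp_closed)
  moreover have "n \<union> K \<noteq> {}" "s \<union> L \<union> R \<noteq> {}" using ns(7,8) by auto
  moreover have "S \<union> closing_arcs 1 = (n \<union> K) \<union> (s \<union> L \<union> R)" using KL(1) ns(1) by blast
  ultimately show ?thesis using not_connected_Un by metis
qed

section \<open>Rotation by a right angle\<close>

lemma ii_dir: "\<i> * dir NW = dir SW" "\<i> * dir SW = dir SE" "\<i> * dir SE = dir NE" "\<i> * dir NE = dir NW"
  unfolding dir_Complex by (auto simp: complex_eq_iff)

lemma ii_image: "linear ((*) \<i>)" "inj ((*) \<i>)"
  by (auto intro!: linear_times inj_onI)

lemma two_strands_ii:
  assumes "two_strands a b c d S R"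
  shows "two_strands (\<i> * a) (\<i> * b) (\<i> * c) (\<i> * d) ((*) \<i> ` S) ((*) \<i> ` R)"
proof -
  obtain K L where KL: "S = K \<union> L \<union> R" "compact K" "connected K" "compact L" "connected L" "compact R"
        "K \<inter> L = {}" "K \<inter> R = {}" "L \<inter> R = {}" "{a, b} \<subseteq> K" "{c, d} \<subseteq> L"
    using assms unfolding two_strands_def by blast
  note i = image_Int[OF ii_image(2), symmetric]
  show ?thesis
    unfolding two_strands_def using KL
    by (intro exI[of _ "(*) \<i> ` K"] exI[of _ "(*) \<i> ` L"])
       (auto simp: image_Un i intro!: compact_continuous_image connected_continuous_image continuous_intros)
qed

text \<open>Rotation permutes the corners cyclically. Exchanging the strands, or the ends within
  each strand, restores the order of the corners in \<open>horizontal_type\<close> and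
  \<open>vertical_type\<close>.\<close>

lemma two_strands_swap: "two_strands a b c d S R \<Longrightarrow> two_strands c d a b S R"
  unfolding two_strands_def by (elim exE, rule_tac x = L in exI, rule_tac x = K in exI) blast

lemma two_strands_flip: "two_strands a b c d S R \<Longrightarrow> two_strands b a d c S R"
  unfolding two_strands_def by (simp add: insert_commute)

lemma ii_cball: "S \<subseteq> cball 0 1 \<Longrightarrow> (*) \<i> ` S \<subseteq> cball 0 1"
  by (auto simp: norm_mult)

lemma vertical_type_ii: "vertical_type S R \<Longrightarrow> horizontal_type ((*) \<i> ` S) ((*) \<i> ` R)"
  using two_strands_swap[OF two_strands_ii[of "dir NW" "dir SW" "dir NE" "dir SE" S R, unfolded ii_dir]]
  by (simp add: vertical_type_def horizontal_type_def ii_cball)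

lemma horizontal_type_ii: "horizontal_type S R \<Longrightarrow> vertical_type ((*) \<i> ` S) ((*) \<i> ` R)"
  using two_strands_flip[OF two_strands_ii[of "dir NW" "dir NE" "dir SW" "dir SE" S R, unfolded ii_dir]]
  by (simp add: vertical_type_def horizontal_type_def ii_cball)

lemma planar_type_ii: "planar_type S \<Longrightarrow> planar_type ((*) \<i> ` S)"
  unfolding planar_type_def using vertical_type_ii horizontal_type_ii by blast

lemma ii_segment: "(*) \<i> ` closed_segment a b = closed_segment (\<i> * a) (\<i> * b)"
  by (rule closed_segment_linear_image[OF ii_image(1), symmetric])

lemma ii_closing_arcs: "(*) \<i> ` closing_arcs 1 = closing_arcs 2" "(*) \<i> ` closing_arcs 2 = closing_arcs 1"
proof -
  have e: "\<i> * (of_real (sqrt 2) * \<i>) = - of_real (sqrt 2)" "\<i> * (- of_real (sqrt 2) * \<i>) = of_real (sqrt 2)"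
    "\<i> * of_real (sqrt 2) = of_real (sqrt 2) * \<i>" "\<i> * (- of_real (sqrt 2)) = - of_real (sqrt 2) * \<i>"
    by (simp_all add: complex_eq_iff)
  have c1: "closing_arcs 1 =
      closed_segment (dir NW) (of_real (sqrt 2) * \<i>) \<union> closed_segment (dir NE) (of_real (sqrt 2) * \<i>) \<union>
      (closed_segment (dir SW) (- of_real (sqrt 2) * \<i>) \<union> closed_segment (dir SE) (- of_real (sqrt 2) * \<i>))"
    unfolding closing_arcs_def pt_outer Let_def
    by (simp add: closed_segment_commute[of _ "dir NE"] closed_segment_commute[of _ "dir SE"] Un_assoc)
  have c2: "closing_arcs 2 =
      closed_segment (dir NW) (- of_real (sqrt 2)) \<union> closed_segment (dir SW) (- of_real (sqrt 2)) \<union>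
      (closed_segment (dir NE) (of_real (sqrt 2)) \<union> closed_segment (dir SE) (of_real (sqrt 2)))"
    unfolding closing_arcs_def pt_outer Let_def
    by (simp add: closed_segment_commute[of _ "dir SW"] closed_segment_commute[of _ "dir SE"] Un_assoc)
  show "(*) \<i> ` closing_arcs 1 = closing_arcs 2" "(*) \<i> ` closing_arcs 2 = closing_arcs 1"
    unfolding c1 c2 image_Un ii_segment ii_dir e by (simp_all only: Un_ac)
qed

lemma connected_ii: "connected ((*) \<i> ` S) \<longleftrightarrow> connected S"
proof
  assume "connected ((*) \<i> ` S)"
  then have "connected ((*) (- \<i>) ` (*) \<i> ` S)"
    by (rule connected_continuous_image[rotated]) (intro continuous_intros)
  moreover have "(*) (- \<i>) ` (*) \<i> ` S = S"
    by (simp add: image_image flip: mult.assoc)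
  ultimately show "connected S" by simp
qed (intro connected_continuous_image continuous_intros)

text \<open>The quarter turn maps the closing arcs of either index onto those of the other, so it
  exchanges numerator and denominator.\<close>

lemma closure_ii:
  "connected ((*) \<i> ` S \<union> closing_arcs 1) \<longleftrightarrow> connected (S \<union> closing_arcs 2)"
  "connected ((*) \<i> ` S \<union> closing_arcs 2) \<longleftrightarrow> connected (S \<union> closing_arcs 1)"
  using connected_ii[of "S \<union> closing_arcs 2"] connected_ii[of "S \<union> closing_arcs 1"]
  by (simp_all only: image_Un ii_closing_arcs)

lemma closure_2_horizontal:
  "horizontal_type S R \<Longrightarrow> connected (S \<union> closing_arcs 2) \<longleftrightarrow> R = {}"
  using closure_1_vertical[OF horizontal_type_ii] unfolding closure_ii by simp

lemma closure_2_vertical: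
  "vertical_type S R \<Longrightarrow> \<not> connected (S \<union> closing_arcs 2)"
  using closure_1_horizontal[OF vertical_type_ii] unfolding closure_ii by simp

section \<open>Sums of states\<close>

lemma inj_place: "inj (place z)"
  by (rule injI) (simp add: place_def)

lemma place_Int_place: "place z ` A \<inter> place z ` B = {} \<longleftrightarrow> A \<inter> B = {}"
  by (simp add: image_Int[OF inj_place, symmetric])

lemma place_mem: "place z p \<in> place z ` A \<longleftrightarrow> p \<in> A"
  by (simp add: inj_image_mem_iff[OF inj_place])

lemma compact_place: "compact A \<Longrightarrow> compact (place z ` A)"
  unfolding place_def by (intro compact_continuous_image continuous_intros) auto

lemma connected_place: "connected A \<Longrightarrow> connected (place z ` A)"
  unfolding place_def by (intro connected_continuous_image continuous_intros) auto

lemma place_cball: "A \<subseteq> cball 0 1 \<Longrightarrow> place z ` A \<subseteq> cball z (1 / 3)"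
  by (auto simp: place_def dist_norm norm_divide)

lemma place_left_right:
  assumes "A \<subseteq> cball 0 1" "B \<subseteq> cball 0 1"
  shows "place (- 1 / 2) ` A \<inter> place (1 / 2) ` B = {}"
proof -
  have "cball (- 1 / 2) (1 / 3) \<inter> cball (1 / 2 :: complex) (1 / 3) = {}"
    by (rule disjoint_cballI) (simp add: dist_norm)
  then show ?thesis using place_cball[OF assms(1), of "- 1 / 2"] place_cball[OF assms(2), of "1 / 2"] by blast
qed

section \<open>The six segments connecting two summands side by side\<close>

abbreviation (input) left_pt :: "corner \<Rightarrow> complex" where "left_pt q \<equiv> place (- 1 / 2) (dir q)"
abbreviation (input) right_pt :: "corner \<Rightarrow> complex" where "right_pt q \<equiv> place (1 / 2) (dir q)"

definition bridge_N :: "complex set" where "bridge_N = closed_segment (left_pt NE) (right_pt NW)"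
definition bridge_S :: "complex set" where "bridge_S = closed_segment (left_pt SE) (right_pt SW)"
definition bridge_NW :: "complex set" where "bridge_NW = closed_segment (dir NW) (left_pt NW)"
definition bridge_SW :: "complex set" where "bridge_SW = closed_segment (dir SW) (left_pt SW)"
definition bridge_NE :: "complex set" where "bridge_NE = closed_segment (dir NE) (right_pt NE)"
definition bridge_SE :: "complex set" where "bridge_SE = closed_segment (dir SE) (right_pt SE)"

lemmas bridge_defs = bridge_N_def bridge_S_def bridge_NW_def bridge_SW_def bridge_NE_def bridge_SE_def

lemma bridge_compact:
  "compact bridge_N" "compact bridge_S" "compact bridge_NW" "compact bridge_SW" "compact bridge_NE" "compact bridge_SE"
  by (simp_all add: bridge_defs)

lemma bridge_connected:
  "connected bridge_N" "connected bridge_S" "connected bridge_NW" "connected bridge_SW" "connected bridge_NE" "connected bridge_SE"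
  by (simp_all add: bridge_defs)

lemma bridge_ends:
  "left_pt NE \<in> bridge_N" "right_pt NW \<in> bridge_N" "left_pt SE \<in> bridge_S" "right_pt SW \<in> bridge_S"
  "dir NW \<in> bridge_NW" "left_pt NW \<in> bridge_NW" "dir SW \<in> bridge_SW" "left_pt SW \<in> bridge_SW"
  "dir NE \<in> bridge_NE" "right_pt NE \<in> bridge_NE" "dir SE \<in> bridge_SE" "right_pt SE \<in> bridge_SE"
  by (simp_all add: bridge_defs)

text \<open>Rational bounds turn the comparisons of coordinates below into linear
  arithmetic.\<close>

lemma sqrt2_bounds: "7 / 5 \<le> sqrt 2" "sqrt 2 \<le> 3 / 2"
  by (rule real_le_rsqrt, simp add: power2_eq_square) (rule real_le_lsqrt, simp_all add: power2_eq_square)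

lemma bridge_cball:
  "bridge_N \<subseteq> cball 0 1" "bridge_S \<subseteq> cball 0 1" "bridge_NW \<subseteq> cball 0 1" "bridge_SW \<subseteq> cball 0 1"
  "bridge_NE \<subseteq> cball 0 1" "bridge_SE \<subseteq> cball 0 1"
proof -
  have "place z (dir q) \<in> cball 0 1" if "norm z = 1 / 2" for z q
    using that norm_triangle_ineq[of z "dir q / 3"] by (simp add: place_def norm_divide)
  then have "left_pt q \<in> cball 0 1" "right_pt q \<in> cball 0 1" for q
    by simp_all
  then show "bridge_N \<subseteq> cball 0 1" "bridge_S \<subseteq> cball 0 1" "bridge_NW \<subseteq> cball 0 1" "bridge_SW \<subseteq> cball 0 1"
  "bridge_NE \<subseteq> cball 0 1" "bridge_SE \<subseteq> cball 0 1"
    unfolding bridge_defs by (intro closed_segment_subset convex_cball; simp)+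
qed

lemma segment_Re_Im:
  assumes "p \<in> closed_segment a b"
  shows "Re a \<le> c \<Longrightarrow> Re b \<le> c \<Longrightarrow> Re p \<le> c" "c \<le> Re a \<Longrightarrow> c \<le> Re b \<Longrightarrow> c \<le> Re p"
    "Im a \<le> c \<Longrightarrow> Im b \<le> c \<Longrightarrow> Im p \<le> c" "c \<le> Im a \<Longrightarrow> c \<le> Im b \<Longrightarrow> c \<le> Im p"
  using segment_halfplane[OF assms, of "- c" "- 1"] segment_halfplane[OF assms, of c 1]
    segment_halfplane[OF assms, of "- c" "- \<i>"] segment_halfplane[OF assms, of c \<i>]
  by (simp_all add: inner_complex_def)

text \<open>Outer corners have coordinates of modulus \<open>sqrt 2 / 2\<close>, at least 7/10;
  placed corners differ from the centre of their disc by \<open>sqrt 2 / 6\<close> in each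
  coordinate, which lies between 7/30 and 1/4. The regions are coarse, but any two of them are
  separated by one coordinate.\<close>

lemma bridge_region:
  "p \<in> bridge_N \<Longrightarrow> - 3 / 10 \<le> Re p \<and> Re p \<le> 3 / 10 \<and> 1 / 5 \<le> Im p"
  "p \<in> bridge_S \<Longrightarrow> - 3 / 10 \<le> Re p \<and> Re p \<le> 3 / 10 \<and> Im p \<le> - 1 / 5"
  "p \<in> bridge_NW \<Longrightarrow> Re p \<le> - 7 / 10 \<and> 1 / 5 \<le> Im p"
  "p \<in> bridge_SW \<Longrightarrow> Re p \<le> - 7 / 10 \<and> Im p \<le> - 1 / 5"
  "p \<in> bridge_NE \<Longrightarrow> 7 / 10 \<le> Re p \<and> 1 / 5 \<le> Im p"
  "p \<in> bridge_SE \<Longrightarrow> 7 / 10 \<le> Re p \<and> Im p \<le> - 1 / 5"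
  unfolding bridge_defs using sqrt2_bounds
  by (intro conjI; elim segment_Re_Im; simp add: place_def dir_Complex)+

lemma bridge_disjoint:
  "bridge_N \<inter> bridge_S = {}" "bridge_N \<inter> bridge_NW = {}" "bridge_N \<inter> bridge_SW = {}" "bridge_N \<inter> bridge_NE = {}"
  "bridge_N \<inter> bridge_SE = {}" "bridge_S \<inter> bridge_NW = {}" "bridge_S \<inter> bridge_SW = {}" "bridge_S \<inter> bridge_NE = {}"
  "bridge_S \<inter> bridge_SE = {}" "bridge_NW \<inter> bridge_SW = {}" "bridge_NW \<inter> bridge_NE = {}" "bridge_NW \<inter> bridge_SE = {}"
  "bridge_SW \<inter> bridge_NE = {}" "bridge_SW \<inter> bridge_SE = {}" "bridge_NE \<inter> bridge_SE = {}"
  unfolding disjoint_iff by (intro allI impI notI, drule bridge_region, drule bridge_region, linarith)+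

text \<open>The last assumption puts x on or beyond the tangent of the shrunken disc at its marked
  point, so the whole segment stays there and touches the disc at that point alone.\<close>

lemma place_segment_tangent:
  assumes "p \<in> closed_segment (place c (dir q)) x" "p \<in> cball c (1 / 3)" "1 / 3 \<le> dir q \<bullet> (x - c)"
  shows "p = place c (dir q)"
proof -
  have pl: "place c (dir q) = c + (1 / 3) *\<^sub>R dir q"
    by (simp add: place_def scaleR_conv_of_real)
  then have "dir q \<bullet> (place c (dir q) - c) = 1 / 3"
    by (simp add: power2_norm_eq_inner[symmetric])
  then have "1 / 3 + dir q \<bullet> c \<le> dir q \<bullet> p"
    using assms(3) by (intro segment_halfplane[OF assms(1)]) (simp_all add: inner_diff_right)
  then have "p = c + (1 / 3) *\<^sub>R dir q"
    using assms(2) by (intro cball_tangent) (simp_all add: inner_diff_right)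
  then show ?thesis by (simp add: pl)
qed

lemma bridge_Int_cball:
  "bridge_N \<inter> cball (- 1 / 2) (1 / 3) \<subseteq> {left_pt NE}" "bridge_N \<inter> cball (1 / 2) (1 / 3) \<subseteq> {right_pt NW}"
  "bridge_S \<inter> cball (- 1 / 2) (1 / 3) \<subseteq> {left_pt SE}" "bridge_S \<inter> cball (1 / 2) (1 / 3) \<subseteq> {right_pt SW}"
  "bridge_NW \<inter> cball (- 1 / 2) (1 / 3) \<subseteq> {left_pt NW}" "bridge_SW \<inter> cball (- 1 / 2) (1 / 3) \<subseteq> {left_pt SW}"
  "bridge_NE \<inter> cball (1 / 2) (1 / 3) \<subseteq> {right_pt NE}" "bridge_SE \<inter> cball (1 / 2) (1 / 3) \<subseteq> {right_pt SE}"
proof -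
  have s: "sqrt 2 * sqrt 2 = 2" by simp
  have *: "closed_segment (place c (dir q)) x \<inter> cball c (1 / 3) \<subseteq> {place c (dir q)}"
    "closed_segment x (place c (dir q)) \<inter> cball c (1 / 3) \<subseteq> {place c (dir q)}"
    if "1 / 3 \<le> dir q \<bullet> (x - c)" for c q x
    using that place_segment_tangent by (auto simp: closed_segment_commute)
  show "bridge_N \<inter> cball (- 1 / 2) (1 / 3) \<subseteq> {left_pt NE}" "bridge_N \<inter> cball (1 / 2) (1 / 3) \<subseteq> {right_pt NW}"
  "bridge_S \<inter> cball (- 1 / 2) (1 / 3) \<subseteq> {left_pt SE}" "bridge_S \<inter> cball (1 / 2) (1 / 3) \<subseteq> {right_pt SW}"
  "bridge_NW \<inter> cball (- 1 / 2) (1 / 3) \<subseteq> {left_pt NW}" "bridge_SW \<inter> cball (- 1 / 2) (1 / 3) \<subseteq> {left_pt SW}"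
  "bridge_NE \<inter> cball (1 / 2) (1 / 3) \<subseteq> {right_pt NE}" "bridge_SE \<inter> cball (1 / 2) (1 / 3) \<subseteq> {right_pt SE}"
    unfolding bridge_defs
    by (rule *, use sqrt2_bounds in \<open>simp add: place_def dir_Complex inner_complex_def field_simps s\<close>)+
qed

text \<open>Each of these bridges and the disc named with it lie on opposite sides of the imaginary
  axis.\<close>

lemma bridge_Int_cball_empty:
  "bridge_NW \<inter> cball (1 / 2) (1 / 3) = {}" "bridge_SW \<inter> cball (1 / 2) (1 / 3) = {}"
  "bridge_NE \<inter> cball (- 1 / 2) (1 / 3) = {}" "bridge_SE \<inter> cball (- 1 / 2) (1 / 3) = {}"
proof -
  have l: "Re p \<le> - 1 / 6" if "p \<in> cball (- 1 / 2) (1 / 3)" for p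
    using that abs_Re_le_cmod[of "- 1 / 2 - p"] by (simp add: dist_norm)
  have r: "1 / 6 \<le> Re p" if "p \<in> cball (1 / 2) (1 / 3)" for p
    using that abs_Re_le_cmod[of "1 / 2 - p"] by (simp add: dist_norm)
  show "bridge_NW \<inter> cball (1 / 2) (1 / 3) = {}" "bridge_SW \<inter> cball (1 / 2) (1 / 3) = {}"
  "bridge_NE \<inter> cball (- 1 / 2) (1 / 3) = {}" "bridge_SE \<inter> cball (- 1 / 2) (1 / 3) = {}"
    unfolding disjoint_iff
    by (intro allI impI notI, drule bridge_region, (drule r | drule l), linarith)+
qed

lemma Int_empty_subset: "E \<inter> D = {} \<Longrightarrow> X \<subseteq> D \<Longrightarrow> E \<inter> X = {}"
  by blast

text \<open>A bridge can meet a placed summand only at the corner where it docks. The statement is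
  about an arbitrary part X of the summand, so that it applies to single strands and to
  remainders.\<close>

lemma bridge_Int_left:
  assumes "X \<subseteq> cball 0 1"
  shows "dir NE \<notin> X \<Longrightarrow> bridge_N \<inter> place (- 1 / 2) ` X = {}" "dir SE \<notin> X \<Longrightarrow> bridge_S \<inter> place (- 1 / 2) ` X = {}"
    "dir NW \<notin> X \<Longrightarrow> bridge_NW \<inter> place (- 1 / 2) ` X = {}" "dir SW \<notin> X \<Longrightarrow> bridge_SW \<inter> place (- 1 / 2) ` X = {}"
    "bridge_NE \<inter> place (- 1 / 2) ` X = {}" "bridge_SE \<inter> place (- 1 / 2) ` X = {}"
proof -
  have *: "E \<inter> place z ` X = {}" if "E \<inter> cball z (1 / 3) \<subseteq> {place z (dir q)}" "dir q \<notin> X" for E z q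
    using that place_cball[OF assms, of z]
    by (intro Int_empty_by_ends[of E "cball z (1 / 3)" "place z (dir q)" "place z (dir q)"])
      (simp_all add: place_mem)
  show "dir NE \<notin> X \<Longrightarrow> bridge_N \<inter> place (- 1 / 2) ` X = {}" "dir SE \<notin> X \<Longrightarrow> bridge_S \<inter> place (- 1 / 2) ` X = {}"
    "dir NW \<notin> X \<Longrightarrow> bridge_NW \<inter> place (- 1 / 2) ` X = {}" "dir SW \<notin> X \<Longrightarrow> bridge_SW \<inter> place (- 1 / 2) ` X = {}"
    by (fact *[OF bridge_Int_cball(1)] *[OF bridge_Int_cball(3)] *[OF bridge_Int_cball(5)] *[OF bridge_Int_cball(6)])+
  show "bridge_NE \<inter> place (- 1 / 2) ` X = {}" "bridge_SE \<inter> place (- 1 / 2) ` X = {}"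
    using place_cball[OF assms, of "- 1 / 2"] bridge_Int_cball_empty(3,4) by (metis Int_empty_subset)+
qed

lemma bridge_Int_right:
  assumes "X \<subseteq> cball 0 1"
  shows "dir NW \<notin> X \<Longrightarrow> bridge_N \<inter> place (1 / 2) ` X = {}" "dir SW \<notin> X \<Longrightarrow> bridge_S \<inter> place (1 / 2) ` X = {}"
    "dir NE \<notin> X \<Longrightarrow> bridge_NE \<inter> place (1 / 2) ` X = {}" "dir SE \<notin> X \<Longrightarrow> bridge_SE \<inter> place (1 / 2) ` X = {}"
    "bridge_NW \<inter> place (1 / 2) ` X = {}" "bridge_SW \<inter> place (1 / 2) ` X = {}"
proof -
  have *: "E \<inter> place z ` X = {}" if "E \<inter> cball z (1 / 3) \<subseteq> {place z (dir q)}" "dir q \<notin> X" for E z q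
    using that place_cball[OF assms, of z]
    by (intro Int_empty_by_ends[of E "cball z (1 / 3)" "place z (dir q)" "place z (dir q)"])
      (simp_all add: place_mem)
  show "dir NW \<notin> X \<Longrightarrow> bridge_N \<inter> place (1 / 2) ` X = {}" "dir SW \<notin> X \<Longrightarrow> bridge_S \<inter> place (1 / 2) ` X = {}"
    "dir NE \<notin> X \<Longrightarrow> bridge_NE \<inter> place (1 / 2) ` X = {}" "dir SE \<notin> X \<Longrightarrow> bridge_SE \<inter> place (1 / 2) ` X = {}"
    by (fact *[OF bridge_Int_cball(2)] *[OF bridge_Int_cball(4)] *[OF bridge_Int_cball(7)] *[OF bridge_Int_cball(8)])+
  show "bridge_NW \<inter> place (1 / 2) ` X = {}" "bridge_SW \<inter> place (1 / 2) ` X = {}"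
    using place_cball[OF assms, of "1 / 2"] bridge_Int_cball_empty(1,2) by (metis Int_empty_subset)+
qed

section \<open>Horizontal gluing of vertical and horizontal states\<close>

definition hglue :: "complex set \<Rightarrow> complex set \<Rightarrow> complex set" where
  "hglue S T = place (- 1 / 2) ` S \<union> place (1 / 2) ` T \<union>
     (bridge_N \<union> bridge_S \<union> bridge_NW \<union> bridge_SW \<union> bridge_NE \<union> bridge_SE)"

lemma hglue_cball:
  assumes "S \<subseteq> cball 0 1" "T \<subseteq> cball 0 1"
  shows "hglue S T \<subseteq> cball 0 1"
proof -
  have "cball z (1 / 3) \<subseteq> cball 0 1" if "norm z = 1 / 2" for z :: complex
    using that by (intro cball_subset_cball_iff[THEN iffD2]) (simp add: dist_norm)
  then have "cball (- 1 / 2) (1 / 3) \<subseteq> cball (0 :: complex) 1" "cball (1 / 2) (1 / 3) \<subseteq> cball (0 :: complex) 1"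
    by simp_all
  then have "place (- 1 / 2) ` S \<subseteq> cball 0 1" "place (1 / 2) ` T \<subseteq> cball 0 1"
    using place_cball[OF assms(1), of "- 1 / 2"] place_cball[OF assms(2), of "1 / 2"] by blast+
  then show ?thesis
    unfolding hglue_def using bridge_cball by (intro Un_least)
qed

lemma Int_empty_sym: "A \<inter> B = {} \<Longrightarrow> B \<inter> A = {}"
  by blast

text \<open>Disjointness of glued strands reduces to pairs of pieces, and a pair may occur in either
  order, so each fact is kept in both orders.\<close>

lemmas bridge_disjoint_sym = bridge_disjoint[THEN Int_empty_sym]
lemmas bridge_Int_left_sym = bridge_Int_left[THEN Int_empty_sym]
lemmas bridge_Int_right_sym = bridge_Int_right[THEN Int_empty_sym]
lemmas place_left_right_sym = place_left_right[THEN Int_empty_sym]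

lemmas glue_disjoint =
  bridge_disjoint bridge_Int_left bridge_Int_right place_left_right
  bridge_disjoint_sym bridge_Int_left_sym bridge_Int_right_sym place_left_right_sym
  place_Int_place Int_Un_distrib Int_Un_distrib2

lemmas glue_compact = bridge_compact compact_place compact_Un
lemmas glue_connected = bridge_connected connected_place bridge_ends place_mem

text \<open>The inner strands \<open>L1\<close> and \<open>K2\<close> face each other; with the two
  middle bridges they form the new circle, which goes into the remainder and makes it nonempty. The
  outer strands \<open>K1\<close> and \<open>L2\<close> are merely prolonged to the new
  corners.\<close>

lemma hglue_vertical_vertical:
  assumes "vertical_type S1 R1" "vertical_type S2 R2"
  shows "\<exists>R. vertical_type (hglue S1 S2) R \<and> R \<noteq> {}"
proof -
  have S: "S1 \<subseteq> cball 0 1" "S2 \<subseteq> cball 0 1"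
    and ts: "two_strands (dir NW) (dir SW) (dir NE) (dir SE) S1 R1"
      "two_strands (dir NW) (dir SW) (dir NE) (dir SE) S2 R2"
    using assms by (simp_all add: vertical_type_def)
  obtain K1 L1 where 1: "S1 = K1 \<union> L1 \<union> R1" "compact K1" "connected K1" "compact L1" "connected L1" "compact R1"
    "K1 \<inter> L1 = {}" "K1 \<inter> R1 = {}" "L1 \<inter> R1 = {}"
    "dir NW \<in> K1" "dir SW \<in> K1" "dir NE \<in> L1" "dir SE \<in> L1"
    "dir NW \<notin> L1" "dir SW \<notin> L1" "dir NE \<notin> K1" "dir SE \<notin> K1"
    "dir NW \<notin> R1" "dir SW \<notin> R1" "dir NE \<notin> R1" "dir SE \<notin> R1"
    using ts(1) by (rule two_strandsE)
  obtain K2 L2 where 2: "S2 = K2 \<union> L2 \<union> R2" "compact K2" "connected K2" "compact L2" "connected L2" "compact R2"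
    "K2 \<inter> L2 = {}" "K2 \<inter> R2 = {}" "L2 \<inter> R2 = {}"
    "dir NW \<in> K2" "dir SW \<in> K2" "dir NE \<in> L2" "dir SE \<in> L2"
    "dir NW \<notin> L2" "dir SW \<notin> L2" "dir NE \<notin> K2" "dir SE \<notin> K2"
    "dir NW \<notin> R2" "dir SW \<notin> R2" "dir NE \<notin> R2" "dir SE \<notin> R2"
    using ts(2) by (rule two_strandsE)
  have sub: "K1 \<subseteq> cball 0 1" "L1 \<subseteq> cball 0 1" "R1 \<subseteq> cball 0 1" "K2 \<subseteq> cball 0 1" "L2 \<subseteq> cball 0 1" "R2 \<subseteq> cball 0 1"
    using S 1(1) 2(1) by simp_all
  note sym = 1(7-9)[THEN Int_empty_sym] 2(7-9)[THEN Int_empty_sym]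
  let ?K = "bridge_NW \<union> place (- 1 / 2) ` K1 \<union> bridge_SW"
  let ?L = "bridge_NE \<union> place (1 / 2) ` L2 \<union> bridge_SE"
  let ?R = "place (- 1 / 2) ` R1 \<union> place (1 / 2) ` R2 \<union>
    (bridge_N \<union> place (- 1 / 2) ` L1 \<union> bridge_S \<union> place (1 / 2) ` K2)"
  have "two_strands (dir NW) (dir SW) (dir NE) (dir SE) (hglue S1 S2) ?R"
    unfolding two_strands_def
  proof (rule exI[of _ ?K], rule exI[of _ ?L], intro conjI)
    show "hglue S1 S2 = ?K \<union> ?L \<union> ?R"
      unfolding hglue_def 1(1) 2(1) image_Un by (simp only: Un_ac)
    show "compact ?K" "compact ?L" "compact ?R"
      by (simp_all only: glue_compact 1 2)
    \<comment> \<open>Unions associate to the left, so the common points are listed from the end of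
      the chain backwards.\<close>
    show "connected ?K"
      by (rule connected_Un_common[where x = "left_pt SW"],
          rule connected_Un_common[where x = "left_pt NW"])
        (simp_all only: glue_connected 1 2 Un_iff simp_thms)
    show "connected ?L"
      by (rule connected_Un_common[where x = "right_pt SE"],
          rule connected_Un_common[where x = "right_pt NE"])
        (simp_all only: glue_connected 1 2 Un_iff simp_thms)
    show "?K \<inter> ?L = {}" "?K \<inter> ?R = {}" "?L \<inter> ?R = {}"
      by (simp_all only: glue_disjoint 1 2 sym sub simp_thms Un_empty not_False_eq_True)
    show "{dir NW, dir SW} \<subseteq> ?K" "{dir NE, dir SE} \<subseteq> ?L"
      by (simp_all add: bridge_ends)
  qed
  moreover have "?R \<noteq> {}" using bridge_ends(1) by blast
  ultimately show ?thesis using hglue_cball[OF S] unfolding vertical_type_def by blast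
qed

text \<open>The strand \<open>L1\<close> joins the two horizontal strands on the right into a single
  one from NE to SE: through \<open>K2\<close> and the upper middle bridge, along \<open>L1\<close>,
  and back through the lower middle bridge and \<open>L2\<close>. Hence the remainders just carry
  over.\<close>

lemma hglue_vertical_horizontal:
  assumes "vertical_type S1 R1" "horizontal_type S2 R2"
  shows "vertical_type (hglue S1 S2) (place (- 1 / 2) ` R1 \<union> place (1 / 2) ` R2)"
proof -
  have S: "S1 \<subseteq> cball 0 1" "S2 \<subseteq> cball 0 1"
    and ts: "two_strands (dir NW) (dir SW) (dir NE) (dir SE) S1 R1"
      "two_strands (dir NW) (dir NE) (dir SW) (dir SE) S2 R2"
    using assms by (simp_all add: vertical_type_def horizontal_type_def)
  obtain K1 L1 where 1: "S1 = K1 \<union> L1 \<union> R1" "compact K1" "connected K1" "compact L1" "connected L1" "compact R1"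
    "K1 \<inter> L1 = {}" "K1 \<inter> R1 = {}" "L1 \<inter> R1 = {}"
    "dir NW \<in> K1" "dir SW \<in> K1" "dir NE \<in> L1" "dir SE \<in> L1"
    "dir NW \<notin> L1" "dir SW \<notin> L1" "dir NE \<notin> K1" "dir SE \<notin> K1"
    "dir NW \<notin> R1" "dir SW \<notin> R1" "dir NE \<notin> R1" "dir SE \<notin> R1"
    using ts(1) by (rule two_strandsE)
  obtain K2 L2 where 2: "S2 = K2 \<union> L2 \<union> R2" "compact K2" "connected K2" "compact L2" "connected L2" "compact R2"
    "K2 \<inter> L2 = {}" "K2 \<inter> R2 = {}" "L2 \<inter> R2 = {}"
    "dir NW \<in> K2" "dir NE \<in> K2" "dir SW \<in> L2" "dir SE \<in> L2"
    "dir NW \<notin> L2" "dir NE \<notin> L2" "dir SW \<notin> K2" "dir SE \<notin> K2"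
    "dir NW \<notin> R2" "dir NE \<notin> R2" "dir SW \<notin> R2" "dir SE \<notin> R2"
    using ts(2) by (rule two_strandsE)
  have sub: "K1 \<subseteq> cball 0 1" "L1 \<subseteq> cball 0 1" "R1 \<subseteq> cball 0 1" "K2 \<subseteq> cball 0 1" "L2 \<subseteq> cball 0 1" "R2 \<subseteq> cball 0 1"
    using S 1(1) 2(1) by simp_all
  note sym = 1(7-9)[THEN Int_empty_sym] 2(7-9)[THEN Int_empty_sym]
  let ?K = "bridge_NW \<union> place (- 1 / 2) ` K1 \<union> bridge_SW"
  let ?L = "bridge_NE \<union> place (1 / 2) ` K2 \<union> bridge_N \<union> place (- 1 / 2) ` L1 \<union> bridge_S \<union> place (1 / 2) ` L2 \<union> bridge_SE"
  let ?R = "place (- 1 / 2) ` R1 \<union> place (1 / 2) ` R2"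
  have "two_strands (dir NW) (dir SW) (dir NE) (dir SE) (hglue S1 S2) ?R"
    unfolding two_strands_def
  proof (rule exI[of _ ?K], rule exI[of _ ?L], intro conjI)
    show "hglue S1 S2 = ?K \<union> ?L \<union> ?R"
      unfolding hglue_def 1(1) 2(1) image_Un by (simp only: Un_ac)
    show "compact ?K" "compact ?L" "compact ?R"
      by (simp_all only: glue_compact 1 2)
    show "connected ?K"
      by (rule connected_Un_common[where x = "left_pt SW"],
          rule connected_Un_common[where x = "left_pt NW"])
        (simp_all only: glue_connected 1 2 Un_iff simp_thms)
    show "connected ?L"
      by (rule connected_Un_common[where x = "right_pt SE"],
          rule connected_Un_common[where x = "right_pt SW"],
          rule connected_Un_common[where x = "left_pt SE"],
          rule connected_Un_common[where x = "left_pt NE"],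
          rule connected_Un_common[where x = "right_pt NW"],
          rule connected_Un_common[where x = "right_pt NE"])
        (simp_all only: glue_connected 1 2 Un_iff simp_thms)
    show "?K \<inter> ?L = {}" "?K \<inter> ?R = {}" "?L \<inter> ?R = {}"
      by (simp_all only: glue_disjoint 1 2 sym sub simp_thms Un_empty not_False_eq_True)
    show "{dir NW, dir SW} \<subseteq> ?K" "{dir NE, dir SE} \<subseteq> ?L"
      by (simp_all add: bridge_ends)
  qed
  then show ?thesis using hglue_cball[OF S] unfolding vertical_type_def by blast
qed

text \<open>Mirror image of the preceding case: now \<open>K2\<close> joins the two horizontal
  strands on the left into one strand from NW to SW.\<close>

lemma hglue_horizontal_vertical:
  assumes "horizontal_type S1 R1" "vertical_type S2 R2"
  shows "vertical_type (hglue S1 S2) (place (- 1 / 2) ` R1 \<union> place (1 / 2) ` R2)"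
proof -
  have S: "S1 \<subseteq> cball 0 1" "S2 \<subseteq> cball 0 1"
    and ts: "two_strands (dir NW) (dir NE) (dir SW) (dir SE) S1 R1"
      "two_strands (dir NW) (dir SW) (dir NE) (dir SE) S2 R2"
    using assms by (simp_all add: horizontal_type_def vertical_type_def)
  obtain K1 L1 where 1: "S1 = K1 \<union> L1 \<union> R1" "compact K1" "connected K1" "compact L1" "connected L1" "compact R1"
    "K1 \<inter> L1 = {}" "K1 \<inter> R1 = {}" "L1 \<inter> R1 = {}"
    "dir NW \<in> K1" "dir NE \<in> K1" "dir SW \<in> L1" "dir SE \<in> L1"
    "dir NW \<notin> L1" "dir NE \<notin> L1" "dir SW \<notin> K1" "dir SE \<notin> K1"
    "dir NW \<notin> R1" "dir NE \<notin> R1" "dir SW \<notin> R1" "dir SE \<notin> R1"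
    using ts(1) by (rule two_strandsE)
  obtain K2 L2 where 2: "S2 = K2 \<union> L2 \<union> R2" "compact K2" "connected K2" "compact L2" "connected L2" "compact R2"
    "K2 \<inter> L2 = {}" "K2 \<inter> R2 = {}" "L2 \<inter> R2 = {}"
    "dir NW \<in> K2" "dir SW \<in> K2" "dir NE \<in> L2" "dir SE \<in> L2"
    "dir NW \<notin> L2" "dir SW \<notin> L2" "dir NE \<notin> K2" "dir SE \<notin> K2"
    "dir NW \<notin> R2" "dir SW \<notin> R2" "dir NE \<notin> R2" "dir SE \<notin> R2"
    using ts(2) by (rule two_strandsE)
  have sub: "K1 \<subseteq> cball 0 1" "L1 \<subseteq> cball 0 1" "R1 \<subseteq> cball 0 1" "K2 \<subseteq> cball 0 1" "L2 \<subseteq> cball 0 1" "R2 \<subseteq> cball 0 1"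
    using S 1(1) 2(1) by simp_all
  note sym = 1(7-9)[THEN Int_empty_sym] 2(7-9)[THEN Int_empty_sym]
  let ?K = "bridge_NW \<union> place (- 1 / 2) ` K1 \<union> bridge_N \<union> place (1 / 2) ` K2 \<union> bridge_S \<union> place (- 1 / 2) ` L1 \<union> bridge_SW"
  let ?L = "bridge_NE \<union> place (1 / 2) ` L2 \<union> bridge_SE"
  let ?R = "place (- 1 / 2) ` R1 \<union> place (1 / 2) ` R2"
  have "two_strands (dir NW) (dir SW) (dir NE) (dir SE) (hglue S1 S2) ?R"
    unfolding two_strands_def
  proof (rule exI[of _ ?K], rule exI[of _ ?L], intro conjI)
    show "hglue S1 S2 = ?K \<union> ?L \<union> ?R"
      unfolding hglue_def 1(1) 2(1) image_Un by (simp only: Un_ac)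
    show "compact ?K" "compact ?L" "compact ?R"
      by (simp_all only: glue_compact 1 2)
    show "connected ?K"
      by (rule connected_Un_common[where x = "left_pt SW"],
          rule connected_Un_common[where x = "left_pt SE"],
          rule connected_Un_common[where x = "right_pt SW"],
          rule connected_Un_common[where x = "right_pt NW"],
          rule connected_Un_common[where x = "left_pt NE"],
          rule connected_Un_common[where x = "left_pt NW"])
        (simp_all only: glue_connected 1 2 Un_iff simp_thms)
    show "connected ?L"
      by (rule connected_Un_common[where x = "right_pt SE"],
          rule connected_Un_common[where x = "right_pt NE"])
        (simp_all only: glue_connected 1 2 Un_iff simp_thms)
    show "?K \<inter> ?L = {}" "?K \<inter> ?R = {}" "?L \<inter> ?R = {}"
      by (simp_all only: glue_disjoint 1 2 sym sub simp_thms Un_empty not_False_eq_True)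
    show "{dir NW, dir SW} \<subseteq> ?K" "{dir NE, dir SE} \<subseteq> ?L"
      by (simp_all add: bridge_ends)
  qed
  then show ?thesis using hglue_cball[OF S] unfolding vertical_type_def by blast
qed

lemma hglue_horizontal_horizontal:
  assumes "horizontal_type S1 R1" "horizontal_type S2 R2"
  shows "horizontal_type (hglue S1 S2) (place (- 1 / 2) ` R1 \<union> place (1 / 2) ` R2)"
proof -
  have S: "S1 \<subseteq> cball 0 1" "S2 \<subseteq> cball 0 1"
    and ts: "two_strands (dir NW) (dir NE) (dir SW) (dir SE) S1 R1"
      "two_strands (dir NW) (dir NE) (dir SW) (dir SE) S2 R2"
    using assms by (simp_all add: horizontal_type_def)
  obtain K1 L1 where 1: "S1 = K1 \<union> L1 \<union> R1" "compact K1" "connected K1" "compact L1" "connected L1" "compact R1"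
    "K1 \<inter> L1 = {}" "K1 \<inter> R1 = {}" "L1 \<inter> R1 = {}"
    "dir NW \<in> K1" "dir NE \<in> K1" "dir SW \<in> L1" "dir SE \<in> L1"
    "dir NW \<notin> L1" "dir NE \<notin> L1" "dir SW \<notin> K1" "dir SE \<notin> K1"
    "dir NW \<notin> R1" "dir NE \<notin> R1" "dir SW \<notin> R1" "dir SE \<notin> R1"
    using ts(1) by (rule two_strandsE)
  obtain K2 L2 where 2: "S2 = K2 \<union> L2 \<union> R2" "compact K2" "connected K2" "compact L2" "connected L2" "compact R2"
    "K2 \<inter> L2 = {}" "K2 \<inter> R2 = {}" "L2 \<inter> R2 = {}"
    "dir NW \<in> K2" "dir NE \<in> K2" "dir SW \<in> L2" "dir SE \<in> L2"
    "dir NW \<notin> L2" "dir NE \<notin> L2" "dir SW \<notin> K2" "dir SE \<notin> K2"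
    "dir NW \<notin> R2" "dir NE \<notin> R2" "dir SW \<notin> R2" "dir SE \<notin> R2"
    using ts(2) by (rule two_strandsE)
  have sub: "K1 \<subseteq> cball 0 1" "L1 \<subseteq> cball 0 1" "R1 \<subseteq> cball 0 1" "K2 \<subseteq> cball 0 1" "L2 \<subseteq> cball 0 1" "R2 \<subseteq> cball 0 1"
    using S 1(1) 2(1) by simp_all
  note sym = 1(7-9)[THEN Int_empty_sym] 2(7-9)[THEN Int_empty_sym]
  let ?K = "bridge_NW \<union> place (- 1 / 2) ` K1 \<union> bridge_N \<union> place (1 / 2) ` K2 \<union> bridge_NE"
  let ?L = "bridge_SW \<union> place (- 1 / 2) ` L1 \<union> bridge_S \<union> place (1 / 2) ` L2 \<union> bridge_SE"
  let ?R = "place (- 1 / 2) ` R1 \<union> place (1 / 2) ` R2"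
  have "two_strands (dir NW) (dir NE) (dir SW) (dir SE) (hglue S1 S2) ?R"
    unfolding two_strands_def
  proof (rule exI[of _ ?K], rule exI[of _ ?L], intro conjI)
    show "hglue S1 S2 = ?K \<union> ?L \<union> ?R"
      unfolding hglue_def 1(1) 2(1) image_Un by (simp only: Un_ac)
    show "compact ?K" "compact ?L" "compact ?R"
      by (simp_all only: glue_compact 1 2)
    show "connected ?K"
      by (rule connected_Un_common[where x = "right_pt NE"],
          rule connected_Un_common[where x = "right_pt NW"],
          rule connected_Un_common[where x = "left_pt NE"],
          rule connected_Un_common[where x = "left_pt NW"])
        (simp_all only: glue_connected 1 2 Un_iff simp_thms)
    show "connected ?L"
      by (rule connected_Un_common[where x = "right_pt SE"],
          rule connected_Un_common[where x = "right_pt SW"],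
          rule connected_Un_common[where x = "left_pt SE"],
          rule connected_Un_common[where x = "left_pt SW"])
        (simp_all only: glue_connected 1 2 Un_iff simp_thms)
    show "?K \<inter> ?L = {}" "?K \<inter> ?R = {}" "?L \<inter> ?R = {}"
      by (simp_all only: glue_disjoint 1 2 sym sub simp_thms Un_empty not_False_eq_True)
    show "{dir NW, dir NE} \<subseteq> ?K" "{dir SW, dir SE} \<subseteq> ?L"
      by (simp_all add: bridge_ends)
  qed
  then show ?thesis using hglue_cball[OF S] unfolding horizontal_type_def by blast
qed

text \<open>A vertical state is disconnected under the denominator closure, a horizontal one under
  the numerator closure. This exclusion later allows the indicator of a disjunction to be split into
  a sum.\<close>

lemma planar_type_closure_exclusive:
  assumes "planar_type S"
  shows "\<not> (connected (S \<union> closing_arcs 1) \<and> connected (S \<union> closing_arcs 2))"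
  using assms closure_1_horizontal closure_2_vertical unfolding planar_type_def by blast

text \<open>For a vertical state, numerator connectedness means an empty remainder and denominator
  connectedness fails; for a horizontal state the roles are exchanged. The four gluing cases can
  then be read off, and in the doubly vertical one the new circle makes both sides false.\<close>

lemma connected_hglue:
  assumes "planar_type S1" "planar_type S2"
  shows "connected (hglue S1 S2 \<union> closing_arcs 1) \<longleftrightarrow>
      connected (S1 \<union> closing_arcs 1) \<and> connected (S2 \<union> closing_arcs 2) \<or>
      connected (S1 \<union> closing_arcs 2) \<and> connected (S2 \<union> closing_arcs 1)" (is ?num)
    and "connected (hglue S1 S2 \<union> closing_arcs 2) \<longleftrightarrow>
      connected (S1 \<union> closing_arcs 2) \<and> connected (S2 \<union> closing_arcs 2)" (is ?den)
proof -
  note V = closure_1_vertical closure_2_vertical and H = closure_1_horizontal closure_2_horizontal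
  obtain R1 R2 where "vertical_type S1 R1 \<or> horizontal_type S1 R1" "vertical_type S2 R2 \<or> horizontal_type S2 R2"
    using assms unfolding planar_type_def by blast
  then have "?num \<and> ?den"
  proof (elim disjE)
    assume *: "vertical_type S1 R1" "vertical_type S2 R2"
    then obtain R where "vertical_type (hglue S1 S2) R" "R \<noteq> {}"
      using hglue_vertical_vertical by blast
    then show ?thesis using V[OF *(1)] V[OF *(2)] V[of "hglue S1 S2" R] by simp
  next
    assume *: "vertical_type S1 R1" "horizontal_type S2 R2"
    then show ?thesis using V[OF *(1)] H[OF *(2)] V[OF hglue_vertical_horizontal[OF *]] by simp
  next
    assume *: "horizontal_type S1 R1" "vertical_type S2 R2"
    then show ?thesis using H[OF *(1)] V[OF *(2)] V[OF hglue_horizontal_vertical[OF *]] by simp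
  next
    assume *: "horizontal_type S1 R1" "horizontal_type S2 R2"
    then show ?thesis using H[OF *(1)] H[OF *(2)] H[OF hglue_horizontal_horizontal[OF *]] by simp
  qed
  then show ?num ?den by simp_all
qed

section \<open>Vertical gluing as a rotated horizontal gluing\<close>

definition vbridges :: "complex set" where
  "vbridges =
     closed_segment (place (\<i> / 2) (dir SW)) (place (- \<i> / 2) (dir NW)) \<union>
     closed_segment (place (\<i> / 2) (dir SE)) (place (- \<i> / 2) (dir NE)) \<union>
     closed_segment (dir NW) (place (\<i> / 2) (dir NW)) \<union> closed_segment (dir NE) (place (\<i> / 2) (dir NE)) \<union>
     closed_segment (dir SW) (place (- \<i> / 2) (dir SW)) \<union> closed_segment (dir SE) (place (- \<i> / 2) (dir SE))"

definition vglue :: "complex set \<Rightarrow> complex set \<Rightarrow> complex set" where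
  "vglue S T = place (\<i> / 2) ` S \<union> place (- \<i> / 2) ` T \<union> vbridges"

text \<open>The quarter turn takes the upper disc to the left one and the lower disc to the right
  one, so the order of the summands is kept.\<close>

lemma ii_place: "\<i> * place (\<i> / 2) p = place (- 1 / 2) (\<i> * p)" "\<i> * place (- \<i> / 2) p = place (1 / 2) (\<i> * p)"
  by (simp_all add: place_def algebra_simps)

lemma ii_vglue: "(*) \<i> ` vglue S T = hglue ((*) \<i> ` S) ((*) \<i> ` T)"
  unfolding vglue_def vbridges_def hglue_def bridge_defs image_Un ii_segment image_image ii_place ii_dir
  by (simp only: Un_ac)

text \<open>Since rotation exchanges the closures, the conjunction of the horizontal case moves to
  the numerator and the disjunction to the denominator.\<close>

lemma connected_vglue:
  assumes "planar_type S1" "planar_type S2"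
  shows "connected (vglue S1 S2 \<union> closing_arcs 1) \<longleftrightarrow>
      connected (S1 \<union> closing_arcs 1) \<and> connected (S2 \<union> closing_arcs 1)"
    and "connected (vglue S1 S2 \<union> closing_arcs 2) \<longleftrightarrow>
      connected (S1 \<union> closing_arcs 1) \<and> connected (S2 \<union> closing_arcs 2) \<or>
      connected (S1 \<union> closing_arcs 2) \<and> connected (S2 \<union> closing_arcs 1)"
  using connected_hglue[OF assms[THEN planar_type_ii]]
  unfolding ii_vglue[symmetric] closure_ii by auto

section \<open>States of tangle diagrams\<close>

text \<open>Filling a hole with a fundamental tangle and splitting a crossing insert the same two
  shapes, so both become one boolean choice per inner disc.\<close>

definition smoothing :: "(disc \<Rightarrow> bool) \<Rightarrow> disc \<Rightarrow> complex set" where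
  "smoothing h D = (if h D then vertical_arcs D else horizontal_arcs D)"

lemma pt_mem_disc_set: "0 \<le> snd D \<Longrightarrow> pt D q \<in> disc_set D"
  by (simp add: pt_def disc_set_def dist_norm norm_mult)

lemma corners_subset: "0 \<le> snd D \<Longrightarrow> corners D \<subseteq> disc_set D"
  unfolding corners_def using pt_mem_disc_set by blast

lemma pt_eq_iff: "0 < snd D \<Longrightarrow> pt D p = pt D q \<longleftrightarrow> p = q"
  by (simp add: pt_def)

lemma smoothing_subset:
  assumes "0 \<le> snd D"
  shows "smoothing h D \<subseteq> disc_set D"
proof -
  have "closed_segment (pt D p) (pt D q) \<subseteq> disc_set D" for p q
    using pt_mem_disc_set[OF assms] by (intro closed_segment_subset) (simp_all add: disc_set_def)
  then show ?thesis by (simp add: smoothing_def vertical_arcs_def horizontal_arcs_def)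
qed

lemma pt_sel:
  "Re (pt D q) = Re (fst D) + snd D * Re (dir q)" "Im (pt D q) = Im (fst D) + snd D * Im (dir q)"
  by (simp_all add: pt_def)

text \<open>Two disjoint segments on four distinct corners: in this form later arguments need not
  distinguish the vertical from the horizontal smoothing. The segments lie at distance
  \<open>snd D * (sqrt 2 / 2)\<close> on either side of the centre, which separates them.\<close>

lemma smoothing_segments:
  assumes "0 < snd D"
  obtains a b c d where "smoothing h D = closed_segment a b \<union> closed_segment c d"
    "corners D = {a, b, c, d}" "distinct [a, b, c, d]" "closed_segment a b \<inter> closed_segment c d = {}"
proof (cases "h D")
  case True
  have "closed_segment (pt D NW) (pt D SW) \<inter> closed_segment (pt D NE) (pt D SE) = {}"
  proof (rule ccontr)
    assume "\<not> ?thesis"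
    then obtain p where p: "p \<in> closed_segment (pt D NW) (pt D SW)" "p \<in> closed_segment (pt D NE) (pt D SE)" by blast
    have "Re p \<le> Re (fst D) - snd D * (sqrt 2 / 2)"
      by (rule segment_Re_Im[OF p(1)]) (simp_all add: pt_sel dir_Complex)
    moreover have "Re (fst D) + snd D * (sqrt 2 / 2) \<le> Re p"
      by (rule segment_Re_Im[OF p(2)]) (simp_all add: pt_sel dir_Complex)
    moreover have "0 < snd D * (sqrt 2 / 2)" using assms by simp
    ultimately show False by linarith
  qed
  then show thesis
    using True assms
    by (intro that[of "pt D NW" "pt D SW" "pt D NE" "pt D SE"])
       (auto simp: smoothing_def vertical_arcs_def corners_eq pt_eq_iff)
next
  case False
  have "closed_segment (pt D NW) (pt D NE) \<inter> closed_segment (pt D SW) (pt D SE) = {}"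
  proof (rule ccontr)
    assume "\<not> ?thesis"
    then obtain p where p: "p \<in> closed_segment (pt D NW) (pt D NE)" "p \<in> closed_segment (pt D SW) (pt D SE)" by blast
    have "Im p \<le> Im (fst D) - snd D * (sqrt 2 / 2)"
      by (rule segment_Re_Im[OF p(2)]) (simp_all add: pt_sel dir_Complex)
    moreover have "Im (fst D) + snd D * (sqrt 2 / 2) \<le> Im p"
      by (rule segment_Re_Im[OF p(1)]) (simp_all add: pt_sel dir_Complex)
    moreover have "0 < snd D * (sqrt 2 / 2)" using assms by simp
    ultimately show False by linarith
  qed
  then show thesis
    using False assms
    by (intro that[of "pt D NW" "pt D NE" "pt D SW" "pt D SE"])
       (auto simp: smoothing_def horizontal_arcs_def corners_eq pt_eq_iff)
qed

text \<open>Two successive gluings along segments. The second segment must also avoid the first,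
  which is the disjointness of the two arcs of a smoothing.\<close>

lemma proper_one_manifold_add_smoothing:
  assumes "proper_one_manifold (- P) P S" "0 < snd D" "corners D \<subseteq> P" "S \<inter> disc_set D \<subseteq> corners D"
  shows "proper_one_manifold (- (P - corners D)) (P - corners D) (S \<union> smoothing h D)"
proof -
  obtain a b c d where e: "smoothing h D = closed_segment a b \<union> closed_segment c d"
    "corners D = {a, b, c, d}" "distinct [a, b, c, d]" "closed_segment a b \<inter> closed_segment c d = {}"
    using assms(2) by (rule smoothing_segments)
  have PS: "P \<subseteq> S" using assms(1) by (simp add: proper_one_manifold_def)
  have sub: "closed_segment a b \<subseteq> disc_set D" "closed_segment c d \<subseteq> disc_set D"
    using smoothing_subset[of D h] assms(2) e(1) by auto
  have mem: "a \<in> P" "b \<in> P" "c \<in> P" "d \<in> P" using assms(3) e(2) by auto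
  have cd: "c \<notin> closed_segment a b" "d \<notin> closed_segment a b" "a \<notin> closed_segment c d" "b \<notin> closed_segment c d"
    using e(4) by (auto simp: disjoint_iff)
  have 1: "closed_segment a b \<inter> S = {a, b}"
  proof
    have "closed_segment a b \<inter> S \<subseteq> {a, b, c, d}" using sub(1) assms(4) e(2) by blast
    then show "closed_segment a b \<inter> S \<subseteq> {a, b}" using cd(1,2) by blast
  qed (use mem PS in auto)
  have 2: "closed_segment c d \<inter> (S \<union> closed_segment a b) = {c, d}"
  proof
    have "closed_segment c d \<inter> S \<subseteq> {a, b, c, d}" using sub(2) assms(4) e(2) by blast
    then show "closed_segment c d \<inter> (S \<union> closed_segment a b) \<subseteq> {c, d}" using cd(3,4) e(4) by blast
  qed (use mem PS in auto)
  have "proper_one_manifold (- (P - {a, b})) (P - {a, b}) (S \<union> closed_segment a b)"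
    using e(3) by (intro proper_one_manifold_add_segment assms(1) mem 1) simp
  then have "proper_one_manifold (- (P - {a, b} - {c, d})) (P - {a, b} - {c, d}) (S \<union> closed_segment a b \<union> closed_segment c d)"
    by (rule proper_one_manifold_add_segment) (use e(3) mem 2 in auto)
  moreover have "P - {a, b} - {c, d} = P - corners D" unfolding e(2) by blast
  ultimately show ?thesis unfolding e(1) by (simp add: Un_assoc)
qed

lemma proper_one_manifold_subset:
  assumes "proper_one_manifold U P S"
  shows "S \<subseteq> U \<union> P"
proof -
  obtain \<K> where "\<Union>\<K> = S" "\<forall>K\<in>\<K>. proper_curve U P K"
    using assms unfolding proper_one_manifold_def by blast
  moreover have "K \<subseteq> U \<union> P" if "proper_curve U P K" for K
    using that unfolding proper_curve_def by blast
  ultimately show ?thesis by (metis Sup_least)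
qed

text \<open>The inner discs are smoothed one at a time, each step deleting the four corners of one
  disc from the boundary until only the outer corners remain.\<close>

lemma smoothed_tangle_manifold:
  assumes T: "tangle_diagram m T"
  shows "proper_one_manifold (- corners outer) (corners outer) (strands T \<union> (\<Union>D\<in>inner_discs T. smoothing h D))"
    and "strands T \<union> (\<Union>D\<in>inner_discs T. smoothing h D) \<subseteq> cball 0 1"
proof -
  let ?I = "inner_discs T"
  have fin: "finite ?I" and pos: "\<And>D. D \<in> ?I \<Longrightarrow> 0 < snd D" and ball: "\<And>D. D \<in> ?I \<Longrightarrow> disc_set D \<subseteq> ball 0 1"
    and disj: "\<And>D E. D \<in> ?I \<Longrightarrow> E \<in> ?I \<Longrightarrow> D \<noteq> E \<Longrightarrow> disc_set D \<inter> disc_set E = {}"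
    and man: "proper_one_manifold (ball 0 1 - (\<Union>D\<in>?I. disc_set D)) (corners outer \<union> (\<Union>D\<in>?I. corners D)) (strands T)"
    using T unfolding tangle_diagram_def inner_discs_def by auto
  let ?U = "ball 0 1 - (\<Union>D\<in>?I. disc_set D)"
  \<comment> \<open>The boundary that is left once the discs in F have been smoothed.\<close>
  let ?P = "\<lambda>F. corners outer \<union> (\<Union>D\<in>?I - F. corners D)"
  have cD: "corners D \<subseteq> disc_set D" if "D \<in> ?I" for D
    using corners_subset pos[OF that] by simp
  have out: "corners outer \<inter> ball 0 1 = {}" "corners outer \<subseteq> cball 0 1"
    unfolding corners_outer by auto
  have "?U \<inter> ?P {} = {}" using out(1) cD by blast
  then have base: "proper_one_manifold (- ?P {}) (?P {}) (strands T)"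
    using man by (intro proper_one_manifold_compl[where U = ?U]) simp_all
  have strands: "strands T \<subseteq> ?U \<union> ?P {}"
    using proper_one_manifold_subset[OF man] by simp
  have step: "proper_one_manifold (- ?P F) (?P F) (strands T \<union> (\<Union>D\<in>F. smoothing h D))"
    if "finite F" "F \<subseteq> ?I" for F
    using that
  proof (induction F rule: finite_induct)
    case empty
    then show ?case using base by simp
  next
    case (insert D F)
    let ?S = "strands T \<union> (\<Union>D\<in>F. smoothing h D)"
    have D: "D \<in> ?I" "D \<notin> F" "F \<subseteq> ?I" using insert by auto
    have other: "corners E \<inter> disc_set D = {}" "smoothing h E \<inter> disc_set D = {}" if "E \<in> ?I" "E \<noteq> D" for E
      using disj[OF D(1) that(1)] that(2) cD[OF that(1)] smoothing_subset[of E h] pos[OF that(1)] by auto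
    have "corners outer \<inter> disc_set D = {}" using out(1) ball[OF D(1)] by blast
    then have "strands T \<inter> disc_set D \<subseteq> corners D"
      using strands D(1) other(1) by blast
    then have "?S \<inter> disc_set D \<subseteq> corners D" using other(2) D by blast
    then have "proper_one_manifold (- (?P F - corners D)) (?P F - corners D) (?S \<union> smoothing h D)"
      using D insert.IH pos[OF D(1)] by (intro proper_one_manifold_add_smoothing) auto
    moreover have "?P F - corners D = ?P (insert D F)"
      using D other(1) cD[OF D(1)] \<open>corners outer \<inter> disc_set D = {}\<close> by blast
    ultimately show ?case by (simp add: Un_ac)
  qed
  show "proper_one_manifold (- corners outer) (corners outer) (strands T \<union> (\<Union>D\<in>inner_discs T. smoothing h D))"
    using step[OF fin] by simp
  have sub: "disc_set D \<subseteq> cball 0 1" if "D \<in> ?I" for D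
    using order_trans[OF ball[OF that] ball_subset_cball] .
  have "?U \<union> ?P {} \<subseteq> cball 0 1"
  proof (intro Un_least UN_least)
    show "?U \<subseteq> cball 0 1" using ball_subset_cball by (rule order_trans[OF Diff_subset])
    show "corners outer \<subseteq> cball 0 1" by (rule out(2))
    show "corners D \<subseteq> cball 0 1" if "D \<in> ?I - {}" for D
      using that order_trans[OF cD sub] by simp
  qed
  then have "strands T \<subseteq> cball 0 1" by (rule order_trans[OF strands])
  moreover have "smoothing h D \<subseteq> cball 0 1" if "D \<in> ?I" for D
    using order_trans[OF smoothing_subset sub[OF that]] pos[OF that] by simp
  ultimately show "strands T \<union> (\<Union>D\<in>inner_discs T. smoothing h D) \<subseteq> cball 0 1" by blast
qed

text \<open>A state before closing. The index j affects only the closing arcs, so both closures of a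
  state can be compared on this common set.\<close>

definition filled :: "tangle \<Rightarrow> nat list \<Rightarrow> crossing set \<Rightarrow> complex set" where
  "filled T \<alpha> \<sigma> = strands T \<union> (\<Union>i<length (holes T). fundamental (\<alpha> ! i) (holes T ! i)) \<union>
     (\<Union>x\<in>\<sigma>. A_split x) \<union> (\<Union>x\<in>crossings T - \<sigma>. B_split x)"

lemma resolve_link_of: "resolve (link_of T j \<alpha>) \<sigma> = filled T \<alpha> \<sigma> \<union> closing_arcs j"
  by (auto simp: resolve_def link_of_def filled_def)

text \<open>Holes are distinct, different crossings have different discs, and no disc is both a hole
  and a crossing; therefore the choice of a smoothing is a function of the disc.\<close>

lemma planar_type_filled:
  assumes T: "tangle_diagram m T" and \<sigma>: "\<sigma> \<subseteq> crossings T"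
  shows "planar_type (filled T \<alpha> \<sigma>)"
proof -
  have dist: "distinct (holes T)" and inj: "inj_on fst (crossings T)" and dj: "set (holes T) \<inter> fst ` crossings T = {}"
    using T by (simp_all add: tangle_diagram_def)
  \<comment> \<open>A disc is smoothed vertically by the filling 1, by an A-type splitting with
    over-strand NE-SW and by a B-type splitting with over-strand NW-SE. The equivalence covers the
    last two.\<close>
  define h where "h D \<longleftrightarrow>
    (\<exists>i<length (holes T). D = holes T ! i \<and> \<alpha> ! i = 1) \<or> (\<exists>v. (D, v) \<in> crossings T \<and> ((D, v) \<in> \<sigma> \<longleftrightarrow> v = Over_NE_SW))" for D
  have hole: "fundamental (\<alpha> ! i) (holes T ! i) = smoothing h (holes T ! i)" if "i < length (holes T)" for i
  proof -
    have "holes T ! i \<notin> fst ` crossings T" using dj that nth_mem by blast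
    then have "(holes T ! i, v) \<notin> crossings T" for v
      using image_eqI[of "holes T ! i" fst "(holes T ! i, v)"] by auto
    moreover have "holes T ! i = holes T ! j \<longleftrightarrow> i = j" if "j < length (holes T)" for j
      using nth_eq_iff_index_eq[OF dist \<open>i < length (holes T)\<close> that] .
    ultimately have "h (holes T ! i) \<longleftrightarrow> \<alpha> ! i = 1"
      unfolding h_def using that by metis
    then show ?thesis by (simp add: fundamental_def smoothing_def)
  qed
  have crossing: "(if x \<in> \<sigma> then A_split x else B_split x) = smoothing h (fst x)" if "x \<in> crossings T" for x
  proof -
    obtain D v where x: "x = (D, v)" by fastforce
    have "D \<notin> set (holes T)" using dj that x by force
    then have "D \<noteq> holes T ! i" if "i < length (holes T)" for i
      using nth_mem[OF that] by metis
    moreover have "(D, w) \<in> crossings T \<longleftrightarrow> w = v" for w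
      using inj_onD[OF inj, of "(D, v)" "(D, w)"] that x by auto
    ultimately have "h D \<longleftrightarrow> ((D, v) \<in> \<sigma> \<longleftrightarrow> v = Over_NE_SW)"
      unfolding h_def by metis
    then show ?thesis by (cases v) (auto simp: x smoothing_def)
  qed
  have "(\<Union>x\<in>\<sigma>. A_split x) \<union> (\<Union>x\<in>crossings T - \<sigma>. B_split x) =
      (\<Union>x\<in>crossings T. if x \<in> \<sigma> then A_split x else B_split x)"
    using \<sigma> by (auto split: if_splits)
  also have "\<dots> = (\<Union>x\<in>crossings T. smoothing h (fst x))" using crossing by simp
  finally have "filled T \<alpha> \<sigma> = strands T \<union> (\<Union>D\<in>inner_discs T. smoothing h D)"
    unfolding filled_def inner_discs_def using hole
    by (simp add: Un_assoc set_conv_nth image_Un) (auto simp: in_set_conv_nth)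
  then show ?thesis
    using smoothed_tangle_manifold[OF T, of h] planar_type_manifold by simp
qed

section \<open>Juxtaposed diagrams and their states\<close>

lemma place_segment: "place z ` closed_segment a b = closed_segment (place z a) (place z b)"
  unfolding closed_segment_image_interval image_image
  by (intro image_cong refl) (simp add: place_def scaleR_conv_of_real algebra_simps add_divide_distrib diff_divide_distrib)

lemma pt_place_disc: "pt (place_disc z D) q = place z (pt D q)"
  by (simp add: pt_def place_disc_def place_def add_divide_distrib)

lemma pt_place_disc_outer: "pt (place_disc z outer) q = place z (dir q)"
  by (simp add: pt_place_disc pt_outer)

lemma arcs_place_disc:
  "vertical_arcs (place_disc z D) = place z ` vertical_arcs D"
  "horizontal_arcs (place_disc z D) = place z ` horizontal_arcs D"
  by (simp_all add: vertical_arcs_def horizontal_arcs_def pt_place_disc image_Un place_segment)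

lemma fundamental_place_disc: "fundamental a (place_disc z D) = place z ` fundamental a D"
  by (simp add: fundamental_def arcs_place_disc)

abbreviation place_crossing :: "complex \<Rightarrow> crossing \<Rightarrow> crossing" where
  "place_crossing z \<equiv> map_prod (place_disc z) id"

lemma split_place_crossing:
  "A_split (place_crossing z x) = place z ` A_split x"
  "B_split (place_crossing z x) = place z ` B_split x"
  by (cases x rule: A_split.cases; simp add: arcs_place_disc)+

lemma inj_place_crossing: "inj (place_crossing z)"
proof -
  have "inj (place_disc z)"
    by (rule injI) (auto simp: place_disc_def place_def prod_eq_iff)
  then show ?thesis by (intro prod.inj_map) simp_all
qed

lemma UN_lessThan_add: "(\<Union>i<m + n. f i) = (\<Union>i<m. f i) \<union> (\<Union>i<n. f (m + i :: nat))"
proof -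
  have "{..<m + n} = {..<m} \<union> (+) m ` {..<n}"
    by (simp add: lessThan_atLeast0 ivl_disj_un_two(3) add.commute)
  then show ?thesis by (simp add: UN_Un)
qed

lemma Un_Diff_Un_disjoint:
  "A \<subseteq> C \<Longrightarrow> B \<subseteq> D \<Longrightarrow> C \<inter> D = {} \<Longrightarrow> C \<union> D - (A \<union> B) = (C - A) \<union> (D - B)"
  by blast

text \<open>Because the placed crossing sets are disjoint, the B-split crossings of the combined
  state are those of the two states taken together. The word is cut at the number of holes of the
  first tangle.\<close>

lemma filled_juxtapose:
  assumes "length \<alpha> = length (holes T)" "\<sigma> \<subseteq> crossings T" "\<sigma>' \<subseteq> crossings T'"
    and disj: "place_crossing z ` crossings T \<inter> place_crossing z' ` crossings T' = {}"
  shows "filled (juxtapose z z' J T T') (\<alpha> @ \<beta>) (place_crossing z ` \<sigma> \<union> place_crossing z' ` \<sigma>') =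
    place z ` filled T \<alpha> \<sigma> \<union> place z' ` filled T' \<beta> \<sigma>' \<union> J"
proof -
  let ?C = "place_crossing z ` crossings T" and ?C' = "place_crossing z' ` crossings T'"
  have "?C \<union> ?C' - (place_crossing z ` \<sigma> \<union> place_crossing z' ` \<sigma>') =
      (?C - place_crossing z ` \<sigma>) \<union> (?C' - place_crossing z' ` \<sigma>')"
    by (intro Un_Diff_Un_disjoint image_mono assms)
  also have "\<dots> = place_crossing z ` (crossings T - \<sigma>) \<union> place_crossing z' ` (crossings T' - \<sigma>')"
    by (simp add: image_set_diff[OF inj_place_crossing])
  finally have rest: "?C \<union> ?C' - (place_crossing z ` \<sigma> \<union> place_crossing z' ` \<sigma>') =
      place_crossing z ` (crossings T - \<sigma>) \<union> place_crossing z' ` (crossings T' - \<sigma>')" .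
  have left: "(\<Union>i<length (holes T). fundamental ((\<alpha> @ \<beta>) ! i) ((map (place_disc z) (holes T) @ map (place_disc z') (holes T')) ! i)) =
      place z ` (\<Union>i<length (holes T). fundamental (\<alpha> ! i) (holes T ! i))"
    unfolding image_UN
    by (rule SUP_cong) (simp_all add: nth_append assms(1) fundamental_place_disc)
  have right: "(\<Union>i<length (holes T'). fundamental ((\<alpha> @ \<beta>) ! (length (holes T) + i))
         ((map (place_disc z) (holes T) @ map (place_disc z') (holes T')) ! (length (holes T) + i))) =
      place z' ` (\<Union>i<length (holes T'). fundamental (\<beta> ! i) (holes T' ! i))"
    unfolding image_UN
    by (rule SUP_cong) (simp_all add: nth_append assms(1) fundamental_place_disc)
  show ?thesis
    unfolding filled_def juxtapose_def
    by (simp add: UN_lessThan_add left right rest UN_Un split_place_crossing image_Un image_UN Un_ac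
        del: map_append)
qed

section \<open>Weights and sums over states\<close>

definition state_weight :: "crossing set \<Rightarrow> crossing set \<Rightarrow> complex" where
  "state_weight C \<sigma> = kauffman_A powi (int (card \<sigma>) - int (card (C - \<sigma>)))"

lemma closing_arcs_nonempty: "closing_arcs j \<noteq> {}"
  by (simp add: closing_arcs_def Let_def)

text \<open>Here the count of circles in the bracket becomes a connectedness condition; for a closed
  state, nonemptiness is supplied by the closing arcs.\<close>

lemma card_components_eq_1: "card (components S) = 1 \<longleftrightarrow> connected S \<and> S \<noteq> {}"
proof
  assume "card (components S) = 1"
  then obtain C where "components S = {C}" by (auto simp: card_1_singleton_iff)
  moreover from this have "C = S" using Union_components[of S] by simp
  ultimately show "connected S \<and> S \<noteq> {}"
    by (metis components_eq_sing_iff)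
next
  assume "connected S \<and> S \<noteq> {}"
  then have "components S = {S}" by (simp add: components_eq_sing_iff)
  then show "card (components S) = 1" by simp
qed

text \<open>Writing the condition as a 0-1 factor lets the sum range over all sets of crossings, a
  range that factors under juxtaposition.\<close>

lemma bracket_link_of:
  assumes "finite (crossings T)"
  shows "bracket (link_of T j \<alpha>) = (\<Sum>\<sigma>\<in>Pow (crossings T).
    state_weight (crossings T) \<sigma> * of_bool (connected (filled T \<alpha> \<sigma> \<union> closing_arcs j)))"
proof -
  have "num_circles (link_of T j \<alpha>) \<sigma> = 1 \<longleftrightarrow> connected (filled T \<alpha> \<sigma> \<union> closing_arcs j)" for \<sigma>
    unfolding num_circles_def resolve_link_of card_components_eq_1 using closing_arcs_nonempty by simp
  moreover have "crossings (link_of T j \<alpha>) = crossings T" by (simp add: link_of_def)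
  ultimately have "bracket (link_of T j \<alpha>) =
      (\<Sum>\<sigma> | \<sigma> \<in> Pow (crossings T) \<and> connected (filled T \<alpha> \<sigma> \<union> closing_arcs j). state_weight (crossings T) \<sigma>)"
    unfolding bracket_def state_weight_def Pow_iff by simp
  also have "\<dots> = (\<Sum>\<sigma>\<in>Pow (crossings T).
    if connected (filled T \<alpha> \<sigma> \<union> closing_arcs j) then state_weight (crossings T) \<sigma> else 0)"
    using assms sum.inter_filter[of "Pow (crossings T)"] by simp
  also have "\<dots> = (\<Sum>\<sigma>\<in>Pow (crossings T).
    state_weight (crossings T) \<sigma> * of_bool (connected (filled T \<alpha> \<sigma> \<union> closing_arcs j)))"
    by (rule sum.cong) simp_all
  finally show ?thesis .
qed

text \<open>The exponent, A-type minus B-type splittings, is additive over disjoint sets of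
  crossings.\<close>

lemma state_weight_Un:
  assumes "finite C" "finite C'" "inj_on f C" "inj_on g C'" "f ` C \<inter> g ` C' = {}" "\<sigma> \<subseteq> C" "\<sigma>' \<subseteq> C'"
  shows "state_weight (f ` C \<union> g ` C') (f ` \<sigma> \<union> g ` \<sigma>') = state_weight C \<sigma> * state_weight C' \<sigma>'"
proof -
  have card: "card (f ` A \<union> g ` B) = card A + card B" if "A \<subseteq> C" "B \<subseteq> C'" for A B
  proof -
    have "f ` A \<inter> g ` B = {}" using assms(5) that by blast
    then show ?thesis
      using that assms(1-4) by (simp add: card_Un_disjoint card_image inj_on_subset finite_subset)
  qed
  have "f ` C \<union> g ` C' - (f ` \<sigma> \<union> g ` \<sigma>') = (f ` C - f ` \<sigma>) \<union> (g ` C' - g ` \<sigma>')"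
    by (intro Un_Diff_Un_disjoint image_mono assms)
  also have "\<dots> = f ` (C - \<sigma>) \<union> g ` (C' - \<sigma>')"
    using assms by (simp add: inj_on_image_set_diff[OF assms(3)] inj_on_image_set_diff[OF assms(4)])
  finally have "card (f ` C \<union> g ` C' - (f ` \<sigma> \<union> g ` \<sigma>')) = card (C - \<sigma>) + card (C' - \<sigma>')"
    using card[of "C - \<sigma>" "C' - \<sigma>'"] by simp
  moreover have "kauffman_A \<noteq> 0" by (simp add: kauffman_A_def)
  ultimately show ?thesis
    unfolding state_weight_def by (simp add: card[OF assms(6,7)] add_diff_add power_int_add)
qed

lemma sum_Pow_Un:
  assumes "inj_on f C" "inj_on g C'" "f ` C \<inter> g ` C' = {}"
  shows "(\<Sum>\<rho>\<in>Pow (f ` C \<union> g ` C'). F \<rho>) = (\<Sum>\<sigma>\<in>Pow C. \<Sum>\<sigma>'\<in>Pow C'. F (f ` \<sigma> \<union> g ` \<sigma>'))"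
proof -
  let ?h = "\<lambda>(\<sigma>, \<sigma>'). f ` \<sigma> \<union> g ` \<sigma>'"
  have "inj_on ?h (Pow C \<times> Pow C')"
  proof (rule inj_onI, clarify)
    fix s s' t t' assume st: "s \<subseteq> C" "s' \<subseteq> C'" "t \<subseteq> C" "t' \<subseteq> C'" and "f ` s \<union> g ` s' = f ` t \<union> g ` t'"
    then have "(f ` s \<union> g ` s') \<inter> f ` C = (f ` t \<union> g ` t') \<inter> f ` C"
      "(f ` s \<union> g ` s') \<inter> g ` C' = (f ` t \<union> g ` t') \<inter> g ` C'" by simp_all
    moreover have "(f ` u \<union> g ` u') \<inter> f ` C = f ` u" "(f ` u \<union> g ` u') \<inter> g ` C' = g ` u'"
      if "u \<subseteq> C" "u' \<subseteq> C'" for u u'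
      using assms(3) that by blast+
    ultimately have "f ` s = f ` t" "g ` s' = g ` t'" using st by simp_all
    then show "s = t \<and> s' = t'"
      using inj_on_image_eq_iff[OF assms(1)] inj_on_image_eq_iff[OF assms(2)] st by simp
  qed
  moreover have "?h ` (Pow C \<times> Pow C') = Pow (f ` C \<union> g ` C')"
  proof
    show "Pow (f ` C \<union> g ` C') \<subseteq> ?h ` (Pow C \<times> Pow C')"
    proof
      fix \<rho> assume "\<rho> \<in> Pow (f ` C \<union> g ` C')"
      \<comment> \<open>Pulling \<rho> back along f and g recovers the pair of states.\<close>
      then have "\<rho> = ?h (C \<inter> f -` \<rho>, C' \<inter> g -` \<rho>)" by auto
      then show "\<rho> \<in> ?h ` (Pow C \<times> Pow C')" by (rule image_eqI) simp
    qed
  qed auto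
  ultimately have "bij_betw ?h (Pow C \<times> Pow C') (Pow (f ` C \<union> g ` C'))"
    by (simp add: bij_betw_def)
  from sum.reindex_bij_betw[OF this, of F] show ?thesis
    by (simp add: sum.cartesian_product case_prod_unfold)
qed

lemma bracket_juxtapose:
  assumes "finite (crossings T)" "finite (crossings T')" "length \<alpha> = length (holes T)"
    and disj: "place_crossing z ` crossings T \<inter> place_crossing z' ` crossings T' = {}"
  shows "bracket (link_of (juxtapose z z' J T T') j (\<alpha> @ \<beta>)) =
    (\<Sum>\<sigma>\<in>Pow (crossings T). \<Sum>\<sigma>'\<in>Pow (crossings T').
      state_weight (crossings T) \<sigma> * state_weight (crossings T') \<sigma>' *
      of_bool (connected (place z ` filled T \<alpha> \<sigma> \<union> place z' ` filled T' \<beta> \<sigma>' \<union> J \<union> closing_arcs j)))"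
proof -
  let ?f = "place_crossing z" and ?g = "place_crossing z'"
  have C: "crossings (juxtapose z z' J T T') = ?f ` crossings T \<union> ?g ` crossings T'"
    by (simp add: juxtapose_def)
  have inj: "inj_on ?f A" "inj_on ?g B" for A B
    using inj_on_subset[OF inj_place_crossing] by blast+
  show ?thesis
    using assms
    by (subst bracket_link_of, simp add: C, unfold C, subst sum_Pow_Un[OF inj disj])
       (intro sum.cong refl, simp add: state_weight_Un[OF assms(1,2) inj disj] filled_juxtapose)
qed

lemma tangle_diagram_crossing_center:
  assumes "tangle_diagram m T" "x \<in> crossings T"
  shows "norm (fst (fst x)) < 1"
proof -
  have "fst x \<in> inner_discs T" using assms(2) by (simp add: inner_discs_def)
  then have "0 < snd (fst x)" "disc_set (fst x) \<subseteq> ball 0 1"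
    using assms(1) unfolding tangle_diagram_def by blast+
  moreover from this(1) have "fst (fst x) \<in> disc_set (fst x)" by (simp add: disc_set_def)
  ultimately show ?thesis by auto
qed

text \<open>Centres of crossings lie in the open unit disc, so their placed copies are at distance
  less than 1/3 from z and z'. A coincidence of copies would bring z and z' closer than 2/3.\<close>

lemma place_crossing_disjoint:
  assumes "tangle_diagram m T" "tangle_diagram m' T'" "2 / 3 \<le> norm (z - z')"
  shows "place_crossing z ` crossings T \<inter> place_crossing z' ` crossings T' = {}"
proof -
  have "place_crossing z x \<noteq> place_crossing z' y" if "x \<in> crossings T" "y \<in> crossings T'" for x y
  proof
    assume "place_crossing z x = place_crossing z' y"
    then have "place z (fst (fst x)) = place z' (fst (fst y))"
      by (simp add: place_disc_def prod_eq_iff)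
    then have "z - z' = (fst (fst y) - fst (fst x)) / 3"
      by (simp add: place_def algebra_simps diff_divide_distrib)
    then have "norm (z - z') = norm ((fst (fst y) - fst (fst x)) / 3)" by (rule arg_cong)
    also have "\<dots> = norm (fst (fst y) - fst (fst x)) / 3" by (simp add: norm_divide)
    also have "\<dots> < 2 / 3"
      using norm_triangle_ineq4[of "fst (fst y)" "fst (fst x)"]
        tangle_diagram_crossing_center[OF assms(1) that(1)] tangle_diagram_crossing_center[OF assms(2) that(2)]
      by simp
    finally show False using assms(3) by simp
  qed
  note distinct = this
  show ?thesis
  proof (rule equals0I)
    fix p assume "p \<in> place_crossing z ` crossings T \<inter> place_crossing z' ` crossings T'"
    then obtain x y where "x \<in> crossings T" "p = place_crossing z x" "y \<in> crossings T'" "p = place_crossing z' y"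
      by (elim IntE imageE) (rule that)
    then show False using distinct by metis
  qed
qed

lemma sum_product_of_bool:
  fixes w v :: "_ \<Rightarrow> complex"
  shows "(\<Sum>x\<in>A. \<Sum>y\<in>B. w x * v y * of_bool (P x \<and> Q y)) =
    (\<Sum>x\<in>A. w x * of_bool (P x)) * (\<Sum>y\<in>B. v y * of_bool (Q y))"
  unfolding sum_product by (intro sum.cong refl) (simp add: of_bool_conj)

text \<open>As P and P' exclude each other, the indicator of the disjunction is the sum of two
  indicators, and each of the two double sums factors.\<close>

lemma sum_product_of_bool_disj:
  fixes w v :: "_ \<Rightarrow> complex"
  assumes "\<And>x. x \<in> A \<Longrightarrow> \<not> (P x \<and> P' x)"
  shows "(\<Sum>x\<in>A. \<Sum>y\<in>B. w x * v y * of_bool (P x \<and> Q y \<or> P' x \<and> Q' y)) =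
    (\<Sum>x\<in>A. w x * of_bool (P x)) * (\<Sum>y\<in>B. v y * of_bool (Q y)) +
    (\<Sum>x\<in>A. w x * of_bool (P' x)) * (\<Sum>y\<in>B. v y * of_bool (Q' y))"
proof -
  have "(\<Sum>x\<in>A. \<Sum>y\<in>B. w x * v y * of_bool (P x \<and> Q y \<or> P' x \<and> Q' y)) =
    (\<Sum>x\<in>A. \<Sum>y\<in>B. w x * v y * of_bool (P x \<and> Q y) + w x * v y * of_bool (P' x \<and> Q' y))"
    using assms by (intro sum.cong refl) (auto simp: of_bool_def)
  then show ?thesis by (simp only: sum.distrib sum_product_of_bool)
qed

section \<open>The bracket of a sum and the invariant\<close>

lemma hsum_juxtapose:
  "T +\<^sub>h T' = juxtapose (- 1 / 2) (1 / 2)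
     (bridge_N \<union> bridge_S \<union> bridge_NW \<union> bridge_SW \<union> bridge_NE \<union> bridge_SE) T T'"
  unfolding hsum_def Let_def pt_place_disc_outer pt_outer bridge_defs ..

lemma vsum_juxtapose:
  "T +\<^sub>v T' = juxtapose (\<i> / 2) (- \<i> / 2) vbridges T T'"
  unfolding vsum_def Let_def pt_place_disc_outer pt_outer vbridges_def ..

context
  fixes m n :: nat and T T' :: tangle and \<alpha> \<beta> :: "nat list"
  assumes T: "tangle_diagram m T" and T': "tangle_diagram n T'" and \<alpha>: "length \<alpha> = m"
begin

lemma tangle_finite_crossings: "finite (crossings T)" "finite (crossings T')"
  using T T' by (simp_all add: tangle_diagram_def)

lemma tangle_length_word: "length \<alpha> = length (holes T)"
  using T \<alpha> by (simp add: tangle_diagram_def)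

lemma bracket_hsum_states:
  "bracket (link_of (T +\<^sub>h T') j (\<alpha> @ \<beta>)) =
    (\<Sum>\<sigma>\<in>Pow (crossings T). \<Sum>\<sigma>'\<in>Pow (crossings T'). state_weight (crossings T) \<sigma> * state_weight (crossings T') \<sigma>' *
      of_bool (connected (hglue (filled T \<alpha> \<sigma>) (filled T' \<beta> \<sigma>') \<union> closing_arcs j)))"
  unfolding hsum_juxtapose hglue_def
  by (rule bracket_juxtapose[OF tangle_finite_crossings tangle_length_word place_crossing_disjoint[OF T T']]) simp

lemma bracket_vsum_states:
  "bracket (link_of (T +\<^sub>v T') j (\<alpha> @ \<beta>)) =
    (\<Sum>\<sigma>\<in>Pow (crossings T). \<Sum>\<sigma>'\<in>Pow (crossings T'). state_weight (crossings T) \<sigma> * state_weight (crossings T') \<sigma>' *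
      of_bool (connected (vglue (filled T \<alpha> \<sigma>) (filled T' \<beta> \<sigma>') \<union> closing_arcs j)))"
  unfolding vsum_juxtapose vglue_def
  by (rule bracket_juxtapose[OF tangle_finite_crossings tangle_length_word place_crossing_disjoint[OF T T']]) simp

lemma exclusive_closures:
  assumes "\<sigma> \<in> Pow (crossings T)"
  shows "\<not> (connected (filled T \<alpha> \<sigma> \<union> closing_arcs 1) \<and> connected (filled T \<alpha> \<sigma> \<union> closing_arcs 2))"
  using planar_type_closure_exclusive[OF planar_type_filled[OF T]] assms by blast

lemma connected_filled_glue:
  assumes "\<sigma> \<in> Pow (crossings T)" "\<sigma>' \<in> Pow (crossings T')"
  shows "connected (hglue (filled T \<alpha> \<sigma>) (filled T' \<beta> \<sigma>') \<union> closing_arcs 1) \<longleftrightarrow>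
      connected (filled T \<alpha> \<sigma> \<union> closing_arcs 1) \<and> connected (filled T' \<beta> \<sigma>' \<union> closing_arcs 2) \<or>
      connected (filled T \<alpha> \<sigma> \<union> closing_arcs 2) \<and> connected (filled T' \<beta> \<sigma>' \<union> closing_arcs 1)"
    "connected (hglue (filled T \<alpha> \<sigma>) (filled T' \<beta> \<sigma>') \<union> closing_arcs 2) \<longleftrightarrow>
      connected (filled T \<alpha> \<sigma> \<union> closing_arcs 2) \<and> connected (filled T' \<beta> \<sigma>' \<union> closing_arcs 2)"
    "connected (vglue (filled T \<alpha> \<sigma>) (filled T' \<beta> \<sigma>') \<union> closing_arcs 1) \<longleftrightarrow>
      connected (filled T \<alpha> \<sigma> \<union> closing_arcs 1) \<and> connected (filled T' \<beta> \<sigma>' \<union> closing_arcs 1)"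
    "connected (vglue (filled T \<alpha> \<sigma>) (filled T' \<beta> \<sigma>') \<union> closing_arcs 2) \<longleftrightarrow>
      connected (filled T \<alpha> \<sigma> \<union> closing_arcs 1) \<and> connected (filled T' \<beta> \<sigma>' \<union> closing_arcs 2) \<or>
      connected (filled T \<alpha> \<sigma> \<union> closing_arcs 2) \<and> connected (filled T' \<beta> \<sigma>' \<union> closing_arcs 1)"
  using assms
  by (intro connected_hglue connected_vglue planar_type_filled[OF T] planar_type_filled[OF T']; simp)+

lemma bracket_hsum:
  "bracket (link_of (T +\<^sub>h T') 1 (\<alpha> @ \<beta>)) =
    bracket (link_of T 1 \<alpha>) * bracket (link_of T' 2 \<beta>) + bracket (link_of T 2 \<alpha>) * bracket (link_of T' 1 \<beta>)"
  "bracket (link_of (T +\<^sub>h T') 2 (\<alpha> @ \<beta>)) = bracket (link_of T 2 \<alpha>) * bracket (link_of T' 2 \<beta>)"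
  unfolding bracket_hsum_states bracket_link_of[OF tangle_finite_crossings(1)] bracket_link_of[OF tangle_finite_crossings(2)]
  by (simp_all only: connected_filled_glue sum_product_of_bool_disj[OF exclusive_closures] sum_product_of_bool
      cong: sum.cong)

lemma bracket_vsum:
  "bracket (link_of (T +\<^sub>v T') 1 (\<alpha> @ \<beta>)) = bracket (link_of T 1 \<alpha>) * bracket (link_of T' 1 \<beta>)"
  "bracket (link_of (T +\<^sub>v T') 2 (\<alpha> @ \<beta>)) =
    bracket (link_of T 1 \<alpha>) * bracket (link_of T' 2 \<beta>) + bracket (link_of T 2 \<alpha>) * bracket (link_of T' 1 \<beta>)"
  unfolding bracket_vsum_states bracket_link_of[OF tangle_finite_crossings(1)] bracket_link_of[OF tangle_finite_crossings(2)]
  by (simp_all only: connected_filled_glue sum_product_of_bool_disj[OF exclusive_closures] sum_product_of_bool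
      cong: sum.cong)

end

section \<open>Lexicographic position of a concatenated word\<close>

lemma digits_less_power:
  fixes i j :: nat
  assumes "i < 2 ^ m" "j < 2 ^ n"
  shows "2 ^ n * i + j < 2 ^ (m + n)"
proof -
  have "2 ^ n * i + j < 2 ^ n * (i + 1)" using assms by simp
  also have "\<dots> \<le> 2 ^ n * 2 ^ m" using assms by (intro mult_le_mono) auto
  finally show ?thesis by (simp add: power_add mult.commute)
qed

text \<open>Read in binary, with the letters 1 and 2 as digits 0 and 1, a word is its own index;
  appending a word of length n multiplies the index by \<open>2 ^ n\<close> and adds. With i and j
  counted from 0, this is column \<open>2 ^ n * (i - 1) + j\<close> of the count from 1. The
  induction removes the first letter, which decides the half of the list.\<close>

lemma words_nth_append:
  "i < 2 ^ m \<Longrightarrow> j < 2 ^ n \<Longrightarrow> words (m + n) ! (2 ^ n * i + j) = words m ! i @ words n ! j"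
proof (induction m arbitrary: i)
  case 0
  then show ?case by (simp add: words_0)
next
  case (Suc m)
  show ?case
  proof (cases "i < 2 ^ m")
    case True
    then show ?thesis
      using Suc.IH[OF True Suc.prems(2)] digits_less_power[OF True Suc.prems(2)]
      by (simp add: words_Suc nth_append length_words)
  next
    case False
    then obtain i' where i': "i = 2 ^ m + i'" using le_Suc_ex not_less by blast
    then have "i' < 2 ^ m" using Suc.prems(1) by simp
    moreover have "2 ^ n * i + j = 2 ^ (m + n) + (2 ^ n * i' + j)"
      by (simp add: i' algebra_simps power_add)
    ultimately show ?thesis
      using Suc.IH[OF _ Suc.prems(2), of i'] digits_less_power[OF _ Suc.prems(2), of i']
      by (simp add: words_Suc nth_append length_words i')
  qed
qed

lemma length_words_nth: "i < 2 ^ m \<Longrightarrow> length (words m ! i) = m"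
  using set_words[of m] nth_mem[of i "words m"] by (simp add: length_words)

section \<open>Integer matrices up to eighth roots of unity\<close>

lemma real_root_of_unity_8:
  fixes r :: real
  assumes "r ^ 8 = 1"
  shows "r = 1 \<or> r = - 1"
proof -
  have "\<bar>r\<bar> ^ 8 = 1" using assms by (simp add: power_even_abs)
  then have "\<bar>r\<bar> = 1" using power_eq_1_iff[of "\<bar>r\<bar>" 8] by simp
  then show ?thesis by linarith
qed

text \<open>Two integer matrices among the multiples of X differ by a factor u with
  \<open>u ^ 8 = 1\<close>. A nonzero entry of M makes u a quotient of integers, hence real and
  equal to 1 or -1; if M vanishes, so does every other representative.\<close>

lemma F_inv_eq_pm_class:
  assumes z: "z ^ 8 = 1" and M: "map_mat of_int M = z \<cdot>\<^sub>m X_mat m T"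
  shows "F_inv m T = pm_class M"
proof -
  let ?X = "X_mat m T"
  have dX: "dim_row ?X = 2" "dim_col ?X = 2 ^ m" by (simp_all add: X_mat_def)
  have ent: "of_int (N $$ (r, k)) = w * ?X $$ (r, k) \<and> dim_row N = 2 \<and> dim_col N = 2 ^ m"
    if "map_mat of_int N = w \<cdot>\<^sub>m ?X" "r < 2" "k < 2 ^ m" for N :: "int mat" and w r k
  proof -
    have d: "dim_row N = 2" "dim_col N = 2 ^ m"
      using arg_cong[OF that(1), of dim_row] arg_cong[OF that(1), of dim_col] dX by simp_all
    then show ?thesis
      using arg_cong[OF that(1), of "\<lambda>A. A $$ (r, k)"] that(2,3) dX by simp
  qed
  have dM: "dim_row M = 2" "dim_col M = 2 ^ m" using ent[OF M, of 0 0] by simp_all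
  have z0: "z \<noteq> 0" using z by auto
  show ?thesis
  proof
    show "pm_class M \<subseteq> F_inv m T"
    proof -
      have "map_mat of_int (- M) = (- z) \<cdot>\<^sub>m ?X"
        using ent[OF M] dX dM by (intro eq_matI) auto
      moreover have "(- z) ^ 8 = 1" using z by simp
      ultimately show ?thesis unfolding pm_class_def F_inv_def using z M by blast
    qed
    show "F_inv m T \<subseteq> pm_class M"
    proof
      fix N assume "N \<in> F_inv m T"
      then obtain w where w: "w ^ 8 = 1" "map_mat of_int N = w \<cdot>\<^sub>m ?X"
        unfolding F_inv_def by blast
      define u where "u = w / z"
      have u8: "u ^ 8 = 1" by (simp add: u_def power_divide w z)
      have dN: "dim_row N = 2" "dim_col N = 2 ^ m" using ent[OF w(2), of 0 0] by simp_all
      have uM: "complex_of_int (N $$ (r, k)) = u * of_int (M $$ (r, k))" if "r < 2" "k < 2 ^ m" for r k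
        using ent[OF M that] ent[OF w(2) that] z0 by (simp add: u_def)
      show "N \<in> pm_class M"
      proof (cases "\<exists>r k. r < 2 \<and> k < 2 ^ m \<and> M $$ (r, k) \<noteq> 0")
        case True
        then obtain r k where rk: "r < 2" "k < 2 ^ m" "M $$ (r, k) \<noteq> 0" by blast
        define q :: real where "q = of_int (N $$ (r, k)) / of_int (M $$ (r, k))"
        have uq: "u = of_real q" using uM[OF rk(1,2)] rk(3) by (simp add: q_def field_simps)
        then have "q ^ 8 = 1" using u8 by (metis of_real_1 of_real_eq_iff of_real_power)
        then have "u = 1 \<or> u = - 1" using real_root_of_unity_8 uq by force
        then show ?thesis
        proof
          assume "u = 1"
          then have "N = M" using uM dM dN by (intro eq_matI) auto
          then show ?thesis by (simp add: pm_class_def)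
        next
          assume "u = - 1"
          then have "complex_of_int (N $$ (r, k)) = of_int (- M $$ (r, k))" if "r < 2" "k < 2 ^ m" for r k
            using uM that by simp
          then have "N = - M" using dM dN by (intro eq_matI) (auto simp only: of_int_eq_iff index_uminus_mat)
          then show ?thesis by (simp add: pm_class_def)
        qed
      next
        case False
        then have "N = M" using uM dM dN by (intro eq_matI) auto
        then show ?thesis by (simp add: pm_class_def)
      qed
    qed
  qed
qed

lemma X_mat_entries:
  assumes "k < 2 ^ m"
  shows "X_mat m T $$ (0, k) = (- \<i>) ^ count_list (words m ! k) 2 * bracket (link_of T 1 (words m ! k))"
    "X_mat m T $$ (1, k) = (- \<i>) ^ count_list (words m ! k) 2 * \<i> * bracket (link_of T 2 (words m ! k))"
  using assms by (simp_all add: X_mat_def Let_def)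

text \<open>Common shape of both sums: f and g give the two rows as integers, and c accounts for the
  different numbers of factors \<open>\<i>\<close> in products of entries and in entries of the sum.
  As \<open>z * w * c\<close> is again an eighth root of unity, the integer matrix built from f and
  g represents the invariant.\<close>

lemma F_inv_juxtaposition:
  assumes a: "a \<in> carrier_mat 2 (2 ^ m)" "F_inv m T1 = pm_class a"
    and b: "b \<in> carrier_mat 2 (2 ^ n)" "F_inv n T2 = pm_class b"
    and c: "c ^ 8 = 1"
    and f: "\<And>z w i j. i < 2 ^ m \<Longrightarrow> j < 2 ^ n \<Longrightarrow>
      map_mat of_int a = z \<cdot>\<^sub>m X_mat m T1 \<Longrightarrow> map_mat of_int b = w \<cdot>\<^sub>m X_mat n T2 \<Longrightarrow>
      of_int (f i j) = z * w * c * X_mat (m + n) T $$ (0, 2 ^ n * i + j) \<and>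
      of_int (g i j) = z * w * c * X_mat (m + n) T $$ (1, 2 ^ n * i + j)"
  shows "\<exists>M \<in> carrier_mat 2 (2 ^ (m + n)).
    (\<forall>i < 2 ^ m. \<forall>j < 2 ^ n. col M (2 ^ n * i + j) = vec_of_list [f i j, g i j]) \<and> F_inv (m + n) T = pm_class M"
proof -
  obtain z where z: "z ^ 8 = 1" "map_mat of_int a = z \<cdot>\<^sub>m X_mat m T1"
    using a(2) unfolding F_inv_def pm_class_def by blast
  obtain w where w: "w ^ 8 = 1" "map_mat of_int b = w \<cdot>\<^sub>m X_mat n T2"
    using b(2) unfolding F_inv_def pm_class_def by blast
  \<comment> \<open>Quotient and remainder modulo \<open>2 ^ n\<close> recover i and j from the
    column index.\<close>
  define M where "M = mat 2 (2 ^ (m + n)) (\<lambda>(r, k). if r = 0 then f (k div 2 ^ n) (k mod 2 ^ n) else g (k div 2 ^ n) (k mod 2 ^ n))"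
  have "col M (2 ^ n * i + j) = vec_of_list [f i j, g i j]" if "i < 2 ^ m" "j < 2 ^ n" for i j
  proof (rule eq_vecI)
    show "dim_vec (col M (2 ^ n * i + j)) = dim_vec (vec_of_list [f i j, g i j])" by (simp add: M_def)
    show "col M (2 ^ n * i + j) $ r = vec_of_list [f i j, g i j] $ r" if "r < dim_vec (vec_of_list [f i j, g i j])" for r
      using that digits_less_power[OF \<open>i < 2 ^ m\<close> \<open>j < 2 ^ n\<close>] \<open>j < 2 ^ n\<close>
      by (cases r) (simp_all add: M_def)
  qed
  moreover have "map_mat of_int M = (z * w * c) \<cdot>\<^sub>m X_mat (m + n) T"
  proof (rule eq_matI)
    fix r k assume "r < dim_row ((z * w * c) \<cdot>\<^sub>m X_mat (m + n) T)" "k < dim_col ((z * w * c) \<cdot>\<^sub>m X_mat (m + n) T)"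
    then have rk: "r < 2" "k < 2 ^ (m + n)" by (simp_all add: X_mat_def)
    have "k div 2 ^ n < 2 ^ m" using rk(2) by (simp add: power_add less_mult_imp_div_less)
    from f[OF this _ z(2) w(2), of "k mod 2 ^ n"] rk
    show "map_mat of_int M $$ (r, k) = ((z * w * c) \<cdot>\<^sub>m X_mat (m + n) T) $$ (r, k)"
      by (cases r) (simp_all add: M_def X_mat_def less_2_cases_iff)
  qed (simp_all add: M_def X_mat_def)
  then have "F_inv (m + n) T = pm_class M"
    by (rule F_inv_eq_pm_class[rotated]) (simp add: power_mult_distrib z w c)
  moreover have "M \<in> carrier_mat 2 (2 ^ (m + n))" by (simp add: M_def)
  ultimately show ?thesis by blast
qed

lemma F_inv_entries:
  assumes "a \<in> carrier_mat 2 (2 ^ m)" "map_mat of_int a = z \<cdot>\<^sub>m X_mat m T" "r < 2" "k < 2 ^ m"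
  shows "complex_of_int (a $$ (r, k)) = z * X_mat m T $$ (r, k)"
  using arg_cong[OF assms(2), of "\<lambda>A. A $$ (r, k)"] assms(1,3,4) by (simp add: X_mat_def)

theorem theorem3p9:
  fixes k1 k2 :: nat and T1 T2 :: tangle and a b :: "int mat"
  assumes "tangle_diagram k1 T1" and "tangle_diagram k2 T2"
    and "a \<in> carrier_mat 2 (2 ^ k1)" and "b \<in> carrier_mat 2 (2 ^ k2)"
    and "F_inv k1 T1 = pm_class a" and "F_inv k2 T2 = pm_class b"
  shows "(\<exists>M \<in> carrier_mat 2 (2 ^ (k1 + k2)).
            (\<forall>i < 2 ^ k1. \<forall>j < 2 ^ k2. col M (2 ^ k2 * i + j) =
               vec_of_list [a $$ (0, i) * b $$ (1, j) + a $$ (1, i) * b $$ (0, j),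
                            a $$ (1, i) * b $$ (1, j)]) \<and>
            F_inv (k1 + k2) (T1 +\<^sub>h T2) = pm_class M) \<and>
         (\<exists>M \<in> carrier_mat 2 (2 ^ (k1 + k2)).
            (\<forall>i < 2 ^ k1. \<forall>j < 2 ^ k2. col M (2 ^ k2 * i + j) =
               vec_of_list [a $$ (0, i) * b $$ (0, j),
                            a $$ (1, i) * b $$ (0, j) + a $$ (0, i) * b $$ (1, j)]) \<and>
            F_inv (k1 + k2) (T1 +\<^sub>v T2) = pm_class M)"
proof -
  note entries = F_inv_entries[OF assms(3)] F_inv_entries[OF assms(4)]
  \<comment> \<open>The second row of \<open>X\<close> carries a factor \<open>\<i>\<close>. In each entry for the horizontal sum, the products
    of entries of the summands carry exactly one such factor more than the entry itself.\<close>
  have "\<i> ^ 8 = 1" by (simp add: eval_nat_numeral)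
  \<comment> \<open>For the vertical sum, products and entries carry equally many such factors, so
    the constant is 1.\<close>
  note h = F_inv_juxtaposition[OF assms(3,5) assms(4,6) this, where T = "T1 +\<^sub>h T2"]
    and v = F_inv_juxtaposition[OF assms(3,5) assms(4,6) power_one, where T = "T1 +\<^sub>v T2"]
  show ?thesis
  proof (intro conjI h v)
    fix z w :: complex and i j :: nat
    assume ij: "i < 2 ^ k1" "j < 2 ^ k2"
      and zw: "map_mat of_int a = z \<cdot>\<^sub>m X_mat k1 T1" "map_mat of_int b = w \<cdot>\<^sub>m X_mat k2 T2"
    note word = words_nth_append[OF ij] length_words_nth[OF ij(1)]
    have rows: "(0 :: nat) < 2" "(1 :: nat) < 2" by simp_all
    \<comment> \<open>The letters 2 of a concatenated word are those of its two parts, so the powers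
      of \<open>- \<i>\<close> multiply and agree on both sides.\<close>
    note simps = rows[THEN entries(1)[OF zw(1) _ ij(1)]] rows[THEN entries(2)[OF zw(2) _ ij(2)]] X_mat_entries[OF ij(1)] X_mat_entries[OF ij(2)]
      X_mat_entries[OF digits_less_power[OF ij]] word(1) power_add count_list_append
      bracket_hsum[OF assms(1,2) word(2)] bracket_vsum[OF assms(1,2) word(2)]
    show "complex_of_int (a $$ (0, i) * b $$ (1, j) + a $$ (1, i) * b $$ (0, j)) =
        z * w * \<i> * X_mat (k1 + k2) (T1 +\<^sub>h T2) $$ (0, 2 ^ k2 * i + j)"
      "complex_of_int (a $$ (1, i) * b $$ (1, j)) =
        z * w * \<i> * X_mat (k1 + k2) (T1 +\<^sub>h T2) $$ (1, 2 ^ k2 * i + j)"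
      "complex_of_int (a $$ (0, i) * b $$ (0, j)) =
        z * w * 1 * X_mat (k1 + k2) (T1 +\<^sub>v T2) $$ (0, 2 ^ k2 * i + j)"
      "complex_of_int (a $$ (1, i) * b $$ (0, j) + a $$ (0, i) * b $$ (1, j)) =
        z * w * 1 * X_mat (k1 + k2) (T1 +\<^sub>v T2) $$ (1, 2 ^ k2 * i + j)"
      unfolding of_int_add of_int_mult simps by (simp_all add: algebra_simps)
  qed
qed

end
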